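(* There exist an integer $n_0$, absolute positive constants $c_1,c_2$, and, for each $\alpha$, positive constants $c_3(\alpha),c_4(\alpha),c_5(\alpha),c_6(\alpha)$ depending only on $\alpha$, for which the following holds. For every $n\ge n_0$, there are a pair of random variables $(X,Y)$ and a dictionary $F=\{f_1,\ldots,f_M\}$ of cardinality $M=\lceil c_1\sqrt{n\log n}\rceil$, for which the quadratic loss $(Y-f(X))^2$ of any element $f\in F$ is bounded by $2$ almost surely, and such that for every $0<\alpha\le 1/2$, if $0<T\le c_2\alpha$, then with probability at least $1-c_3(\alpha)n^{\alpha-1/2}$, the aggregate with exponential weights $\tilde f^{\mathrm{AEW}}$ with temperature $T$, constructed from $n$ i.i.d. copies of $(X,Y)$, satisfies $$R(\tilde f^{\mathrm{AEW}})\ \ge\ \min_{f\in F}R(f)+c_4(\alpha)\sqrt{\frac{\log M}{n}}.$$ Moreover, on the same event, if $f_F^*\in F$ denotes the optimal function in $F$ with respect to the quadratic risk, then there exists $f_j\in F$, $f_j\ne f_F^*$, with excess risk $R(f_j)-R(f_F^* )$ greater than $c_5(\alpha)n^{-1/2}$ and whose weight in the AEW procedure satisfies $\hat\theta_j\ge 1-n^{-c_6(\alpha)/T}$.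
   Context: Let $Z=(X,Y)$, where $X$ takes values in a measurable space $\mathcal X$ and $Y$ is real-valued, and let $Z_i=(X_i,Y_i)$, $1\le i\le n$, be i.i.d. copies of $Z$ (the data $\mathcal D$). The quadratic loss is $Q((X,Y),f)=(Y-f(X))^2$ for measurable $f:\mathcal X\to\mathbb R$; the quadratic risk is $R(f)=\mathbb E\,Q(Z,f)$ and the empirical risk is $R_n(f)=\frac1n\sum_{i=1}^n Q(Z_i,f)$. If $\hat f$ is a function depending on the data, then $R(\hat f)=\mathbb E[Q(Z,\hat f)\mid \mathcal D]$, with $Z$ independent of $\mathcal D$; it is a random variable. A dictionary is a finite set of measurable real-valued functions on $\mathcal X$. For a dictionary $F=\{f_1,\ldots,f_M\}$ and a temperature $T>0$, the aggregate with exponential weights (AEW) is $$\tilde f^{\mathrm{AEW}}=\sum_{j=1}^M\hat\theta_j f_j,\qquad \hat\theta_j=\frac{\exp(-\frac nT R_n(f_j))}{\sum_{k=1}^M\exp(-\frac nT R_n(f_k))}.$$ The optimal function (oracle) $f_F^*\in F$ is a minimizer of $R$ over $F$. *)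

theory Defs
  imports "HOL-Probability.Probability"
begin

definition quad_loss :: "'x \<times> real \<Rightarrow> ('x \<Rightarrow> real) \<Rightarrow> real" where
  "quad_loss z f = (snd z - f (fst z))\<^sup>2"

definition risk :: "'w measure \<Rightarrow> ('w \<Rightarrow> 'x) \<Rightarrow> ('w \<Rightarrow> real) \<Rightarrow> ('x \<Rightarrow> real) \<Rightarrow> real" where
  "risk \<Omega> X Y f = (\<integral>\<omega>. quad_loss (X \<omega>, Y \<omega>) f \<partial>\<Omega>)"

(* The data D are a point of the sample space below; only D 1, ..., D n matter. For a function
   h D computed from the data, the conditional risk given D is risk \<Omega> X Y (h D), because the
   fresh copy of (X, Y) is independent of D. *)
definition emp_risk :: "nat \<Rightarrow> (nat \<Rightarrow> 'x \<times> real) \<Rightarrow> ('x \<Rightarrow> real) \<Rightarrow> real" where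
  "emp_risk n D f = (1 / real n) * (\<Sum>i=1..n. quad_loss (D i) f)"

(* The n-fold product of the joint law of (X, Y): its coordinates are n i.i.d. copies of (X, Y). *)
definition iid_sample ::
  "nat \<Rightarrow> 'w measure \<Rightarrow> 'x measure \<Rightarrow> ('w \<Rightarrow> 'x) \<Rightarrow> ('w \<Rightarrow> real) \<Rightarrow> (nat \<Rightarrow> 'x \<times> real) measure" where
  "iid_sample n \<Omega> S X Y =
     Pi\<^sub>M {1..n} (\<lambda>_. distr \<Omega> (S \<Otimes>\<^sub>M borel) (\<lambda>\<omega>. (X \<omega>, Y \<omega>)))"

(* Elements are extensional, so that two of them are equal exactly when they agree on space S,
   and card F counts distinct functions on the measurable space S. *)
definition dictionary :: "'x measure \<Rightarrow> ('x \<Rightarrow> real) set \<Rightarrow> bool" where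
  "dictionary S F \<longleftrightarrow> finite F \<and> F \<subseteq> borel_measurable S \<inter> extensional (space S)"

(* Weights are indexed by the elements of the dictionary instead of by 1, ..., M. *)
definition aew_weight ::
  "nat \<Rightarrow> real \<Rightarrow> ('x \<Rightarrow> real) set \<Rightarrow> (nat \<Rightarrow> 'x \<times> real) \<Rightarrow> ('x \<Rightarrow> real) \<Rightarrow> real" where
  "aew_weight n T F D f =
     exp (- (real n / T) * emp_risk n D f) / (\<Sum>g\<in>F. exp (- (real n / T) * emp_risk n D g))"

definition aew ::
  "nat \<Rightarrow> real \<Rightarrow> ('x \<Rightarrow> real) set \<Rightarrow> (nat \<Rightarrow> 'x \<times> real) \<Rightarrow> 'x \<Rightarrow> real" where
  "aew n T F D = (\<lambda>x. \<Sum>f\<in>F. aew_weight n T F D f * f x)"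

definition is_oracle ::
  "'w measure \<Rightarrow> ('w \<Rightarrow> 'x) \<Rightarrow> ('w \<Rightarrow> real) \<Rightarrow> ('x \<Rightarrow> real) set \<Rightarrow> ('x \<Rightarrow> real) \<Rightarrow> bool" where
  "is_oracle \<Omega> X Y F f \<longleftrightarrow> is_arg_min (risk \<Omega> X Y) (\<lambda>g. g \<in> F) f"

end

theory Submission
  imports Defs "HOL-Real_Asymp.Real_Asymp"
begin

text \<open>
  The response is \<open>Y = 0\<close> and the input is a vector of \<open>m\<close> independent fair bits. The dictionary
  consists of the \<open>m\<close> coordinates and of one constant. The loss of a coordinate is a fair bit, so its
  risk is \<open>1/2\<close>; the constant is chosen so that its loss is exactly \<open>1/2 - excess n\<close>, where
  \<open>excess n\<close> is a small multiple of \<open>sqrt (ln n / n)\<close>. Hence the constant is the oracle. The cumulated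
  empirical losses of the coordinates are \<open>m\<close> independent binomial variables with parameters \<open>n\<close> and
  \<open>1/2\<close>, while that of the oracle is deterministic. As \<open>m\<close> is at least \<open>sqrt n\<close>, the smallest of the
  binomial variables falls below the loss of the oracle with overwhelming probability
  (\<open>binomial_half_lower_tail\<close>): selection by empirical risk picks a coordinate.

  Exponential weights at temperature \<open>T \<le> 1\<close> put all but a fraction \<open>n powr (- 1 / T)\<close> of the weight
  on the leader as soon as its cumulated empirical loss is smaller than all others by \<open>2 ln n\<close>
  (\<open>aew_weight_ge\<close>). Predictors being nonnegative, the aggregate then has at least the risk of the
  leader, up to a negligible factor (\<open>aew_risk_ge\<close>), and so misses the oracle risk by order
  \<open>sqrt (ln n / n)\<close>.

  What remains is to exclude a near tie at the minimum of the binomial variables. Given all variables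
  but one, a near tie in which this variable is smallest means that it lies in a window of
  length \<open>g\<close>, of order \<open>ln n\<close>, just below the minimum of the others. The consecutive masses of the
  binomial law have ratio \<open>1 + O(sqrt (ln n / n))\<close> in the relevant range, so the window has at
  most a fraction of order \<open>g * sqrt (ln n / n)\<close> of the mass to its left
  (\<open>binomial_half_window\<close>); outside this range the minimum lies with negligible probability, by
  Hoeffding's inequality. A variable to the left of its window is the strict minimiser, which
  happens to at most one variable; summing over the variables, the probability of a near tie is at most
  of order \<open>ln n * sqrt (ln n / n)\<close> (\<open>near_tie_prob\<close>), which is \<open>o(n powr (\<alpha> - 1/2))\<close> for each
  \<open>\<alpha> > 0\<close>. The event depends neither on \<open>\<alpha>\<close> nor on \<open>T\<close>; only the size of \<open>n\<close> from which its
  probability satisfies the bound depends on \<open>\<alpha>\<close>, and the constant \<open>c3 \<alpha>\<close> absorbs this.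
\<close>

section \<open>Product measures of discrete laws\<close>

text \<open>
  The sample law is a product of image measures on an uncountable product space, whereas
  independence is easiest to exploit for discrete products. The identity moves every computation
  to the latter; it holds because both sides agree on boxes.
\<close>

lemma PiM_distr_pmf:
  assumes I: "finite I" and h [measurable]: "h \<in> measurable (measure_pmf p) N"
  shows "Pi\<^sub>M I (\<lambda>_. distr (measure_pmf p) N h) =
           distr (measure_pmf (Pi_pmf I d (\<lambda>_. p))) (Pi\<^sub>M I (\<lambda>_. N)) (\<lambda>\<omega>. \<lambda>i\<in>I. h (\<omega> i))"
proof -
  have hs: "h x \<in> space N" for x
    using h by (auto simp: measurable_def)
  have pr: "prob_space (distr (measure_pmf p) N h)"
    by (intro measure_pmf.prob_space_distr h)
  interpret product_sigma_finite "\<lambda>_. distr (measure_pmf p) N h"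
    by (intro product_sigma_finite.intro prob_space_imp_sigma_finite pr)
  have meas: "(\<lambda>\<omega>. \<lambda>i\<in>I. h (\<omega> i)) \<in> measurable (measure_pmf (Pi_pmf I d (\<lambda>_. p))) (Pi\<^sub>M I (\<lambda>_. N))"
    by (auto simp: space_PiM PiE_def Pi_def hs measurable_def)
  show ?thesis
  proof (rule PiM_eqI[OF I, symmetric])
    show "sets (distr (measure_pmf (Pi_pmf I d (\<lambda>_. p))) (Pi\<^sub>M I (\<lambda>_. N)) (\<lambda>\<omega>. \<lambda>i\<in>I. h (\<omega> i)))
            = sets (Pi\<^sub>M I (\<lambda>_. distr (measure_pmf p) N h))"
      by (auto intro!: sets_PiM_cong)
  next
    fix A :: "'a \<Rightarrow> 'c set"
    assume A: "\<And>i. i \<in> I \<Longrightarrow> A i \<in> sets (distr (measure_pmf p) N h)"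
    have "emeasure (distr (measure_pmf (Pi_pmf I d (\<lambda>_. p))) (Pi\<^sub>M I (\<lambda>_. N)) (\<lambda>\<omega>. \<lambda>i\<in>I. h (\<omega> i))) (Pi\<^sub>E I A)
            = emeasure (measure_pmf (Pi_pmf I d (\<lambda>_. p))) ((\<lambda>\<omega>. \<lambda>i\<in>I. h (\<omega> i)) -` (Pi\<^sub>E I A))"
      using A I by (subst emeasure_distr[OF meas]) (auto intro!: sets_PiM_I_finite)
    also have "(\<lambda>\<omega>. \<lambda>i\<in>I. h (\<omega> i)) -` (Pi\<^sub>E I A) = Pi I (\<lambda>i. h -` A i)"
      by (auto simp: PiE_def Pi_def)
    also have "emeasure (measure_pmf (Pi_pmf I d (\<lambda>_. p))) (Pi I (\<lambda>i. h -` A i))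
                 = (\<Prod>i\<in>I. emeasure (measure_pmf p) (h -` A i))"
      using I by (simp add: measure_pmf.emeasure_eq_measure measure_Pi_pmf_Pi prod_ennreal)
    also have "\<dots> = (\<Prod>i\<in>I. emeasure (distr (measure_pmf p) N h) (A i))"
      using A by (intro prod.cong refl) (simp add: emeasure_distr[OF h])
    finally show "emeasure (distr (measure_pmf (Pi_pmf I d (\<lambda>_. p))) (Pi\<^sub>M I (\<lambda>_. N)) (\<lambda>\<omega>. \<lambda>i\<in>I. h (\<omega> i))) (Pi\<^sub>E I A)
            = (\<Prod>i\<in>I. emeasure (distr (measure_pmf p) N h) (A i))" .
  qed
qed

text \<open>
  An i.i.d. sample of vectors with i.i.d. entries is a matrix with i.i.d. entries. Reading it by
  columns gives the independence of the losses of different predictors.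
\<close>

lemma Pi_pmf_transpose:
  assumes I: "finite I" and J: "finite J"
  shows "map_pmf (\<lambda>\<omega> j i. \<omega> i j) (Pi_pmf I (\<lambda>_. d) (\<lambda>_. Pi_pmf J d (\<lambda>_. q))) =
           Pi_pmf J (\<lambda>_. d) (\<lambda>_. Pi_pmf I d (\<lambda>_. q))"
proof (rule pmf_eqI)
  fix f :: "'b \<Rightarrow> 'a \<Rightarrow> 'c"
  define f' where "f' = (\<lambda>i j. f j i)"
  have inj: "inj (\<lambda>\<omega> j i. \<omega> i j :: 'c)" 
    by (auto simp: inj_def fun_eq_iff)
  have "pmf (map_pmf (\<lambda>\<omega> j i. \<omega> i j) (Pi_pmf I (\<lambda>_. d) (\<lambda>_. Pi_pmf J d (\<lambda>_. q)))) f
          = pmf (Pi_pmf I (\<lambda>_. d) (\<lambda>_. Pi_pmf J d (\<lambda>_. q))) f'"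
    using pmf_map_inj'[OF inj, of _ f'] by (simp add: f'_def)
  also have "\<dots> = pmf (Pi_pmf J (\<lambda>_. d) (\<lambda>_. Pi_pmf I d (\<lambda>_. q))) f"
  proof (cases "\<forall>i j. i \<notin> I \<or> j \<notin> J \<longrightarrow> f j i = d")
    case True
    then have "pmf (Pi_pmf I (\<lambda>_. d) (\<lambda>_. Pi_pmf J d (\<lambda>_. q))) f' = (\<Prod>i\<in>I. \<Prod>j\<in>J. pmf q (f j i))"
      using I J by (subst pmf_Pi') (auto simp: f'_def fun_eq_iff intro!: prod.cong pmf_Pi')
    moreover have "pmf (Pi_pmf J (\<lambda>_. d) (\<lambda>_. Pi_pmf I d (\<lambda>_. q))) f = (\<Prod>j\<in>J. \<Prod>i\<in>I. pmf q (f j i))"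
      using I J True by (subst pmf_Pi') (auto simp: fun_eq_iff intro!: prod.cong pmf_Pi')
    ultimately show ?thesis
      by (simp add: prod.swap[of _ I J])
  next
    case False
    then obtain i j where ij: "i \<notin> I \<or> j \<notin> J" "f j i \<noteq> d" by auto
    have "pmf (Pi_pmf I (\<lambda>_. d) (\<lambda>_. Pi_pmf J d (\<lambda>_. q))) f' = 0"
    proof (cases "i \<in> I")
      case True
      then have "pmf (Pi_pmf J d (\<lambda>_. q)) (f' i) = 0"
        using ij J by (intro pmf_Pi_outside) (auto simp: f'_def)
      then show ?thesis
        using I True by (auto simp: pmf_Pi prod_zero_iff)
    qed (use ij I in \<open>auto simp: f'_def fun_eq_iff intro!: pmf_Pi_outside\<close>)
    moreover have "pmf (Pi_pmf J (\<lambda>_. d) (\<lambda>_. Pi_pmf I d (\<lambda>_. q))) f = 0"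
    proof (cases "j \<in> J")
      case True
      then have "pmf (Pi_pmf I d (\<lambda>_. q)) (f j) = 0"
        using ij I by (intro pmf_Pi_outside) auto
      then show ?thesis
        using J True by (auto simp: pmf_Pi prod_zero_iff)
    qed (use ij J in \<open>auto simp: fun_eq_iff intro!: pmf_Pi_outside\<close>)
    ultimately show ?thesis by simp
  qed
  finally show "pmf (map_pmf (\<lambda>\<omega> j i. \<omega> i j) (Pi_pmf I (\<lambda>_. d) (\<lambda>_. Pi_pmf J d (\<lambda>_. q)))) f
                  = pmf (Pi_pmf J (\<lambda>_. d) (\<lambda>_. Pi_pmf I d (\<lambda>_. q))) f" .
qed

lemma column_counts_Pi_pmf:
  assumes "finite I" "finite J"
  shows "map_pmf (\<lambda>\<omega> j. card {i\<in>I. \<omega> i j})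
             (Pi_pmf I (\<lambda>_. False) (\<lambda>_. Pi_pmf J False (\<lambda>_. bernoulli_pmf (1/2)))) =
           Pi_pmf J 0 (\<lambda>_. binomial_pmf (card I) (1/2))"
proof -
  have "Pi_pmf J 0 (\<lambda>_. binomial_pmf (card I) (1/2)) =
          Pi_pmf J 0 (\<lambda>_. map_pmf (\<lambda>f. card {i\<in>I. f i}) (Pi_pmf I False (\<lambda>_. bernoulli_pmf (1/2))))"
    using assms by (subst binomial_pmf_altdef'[of I _ _ False]) auto
  also have "\<dots> = map_pmf (\<lambda>h. (\<lambda>f. card {i\<in>I. f i}) \<circ> h)
                    (Pi_pmf J (\<lambda>_. False) (\<lambda>_. Pi_pmf I False (\<lambda>_. bernoulli_pmf (1/2))))"
    using assms by (intro Pi_pmf_map) auto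
  also have "Pi_pmf J (\<lambda>_. False) (\<lambda>_. Pi_pmf I False (\<lambda>_. bernoulli_pmf (1/2))) =
      map_pmf (\<lambda>\<omega> j i. \<omega> i j) (Pi_pmf I (\<lambda>_. False) (\<lambda>_. Pi_pmf J False (\<lambda>_. bernoulli_pmf (1/2))))"
    using assms by (intro Pi_pmf_transpose[symmetric])
  finally show ?thesis
    by (simp add: map_pmf_comp o_def)
qed

section \<open>The symmetric binomial law\<close>

text \<open>
  The ratio of consecutive masses is \<open>(n - k) / (k + 1)\<close>, which decreases in \<open>k\<close> and is close to
  \<open>1\<close> as long as \<open>k\<close> is not far below the mean. This is the only fact about the shape of the law that
  the local estimates below rest on.
\<close>
lemma binomial_half_step:
  assumes n: "n > 0" and a: "a \<le> real n / 4" and k: "real n / 2 - a \<le> real k" and a0: "0 \<le> a"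
  shows "pmf (binomial_pmf n (1/2)) (Suc k) \<le> exp (8 * a / n) * pmf (binomial_pmf n (1/2)) k"
proof (cases "k < n")
  case True
  have pm: "pmf (binomial_pmf n (1/2)) i = real (n choose i) * (1/2)^n" if "i \<le> n" for i
    using that by (simp add: power_add[symmetric] flip: power_add)
  have "real (Suc k) * real (n choose Suc k) = real (n - k) * real (n choose k)"
    by (metis binomial_absorb_comp binomial_absorption of_nat_mult)
  then have eq: "real (n choose Suc k) = (real n - real k) / real (Suc k) * real (n choose k)"
    using True by (simp add: field_simps of_nat_diff)
  have "(real n - real k) / real (Suc k) \<le> 1 + 8 * a / n"
  proof -
    have k1: "real n / 4 \<le> real (Suc k)" using k a by simp
    have "real n - real k \<le> real (Suc k) + 2 * a" using k by simp
    also have "2 * a \<le> 8 * a / n * real (Suc k)"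
      using mult_left_mono[OF k1 a0] n by (simp add: field_simps)
    finally show ?thesis by (simp add: divide_le_eq algebra_simps)
  qed
  also have "\<dots> \<le> exp (8 * a / n)" by (rule exp_ge_add_one_self)
  finally have "real (n choose Suc k) \<le> exp (8 * a / n) * real (n choose k)"
    unfolding eq by (intro mult_right_mono) auto
  then show ?thesis using True by (simp add: pm del: pmf_binomial)
next
  case False
  then have "pmf (binomial_pmf n (1/2)) (Suc k) = 0" by simp
  then show ?thesis by (simp del: pmf_binomial)
qed

lemma binomial_half_shift:
  assumes n: "n > 0" and a: "a \<le> real n / 4" and k: "real n / 2 - a \<le> real k" and a0: "0 \<le> a"
  shows "pmf (binomial_pmf n (1/2)) (k + L) \<le> exp (8 * a * L / n) * pmf (binomial_pmf n (1/2)) k"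
proof (induction L)
  case (Suc L)
  have "pmf (binomial_pmf n (1/2)) (k + Suc L) \<le> exp (8 * a / n) * pmf (binomial_pmf n (1/2)) (k + L)"
    using binomial_half_step[OF n a _ a0, of "k + L"] k by (simp del: pmf_binomial)
  also have "\<dots> \<le> exp (8 * a / n) * (exp (8 * a * L / n) * pmf (binomial_pmf n (1/2)) k)"
    by (intro mult_left_mono Suc) auto
  also have "\<dots> = exp (8 * a * Suc L / n) * pmf (binomial_pmf n (1/2)) k"
    by (simp add: exp_add[symmetric] distrib_left add_divide_distrib del: pmf_binomial)
  finally show ?case .
qed (simp del: pmf_binomial)

lemma binomial_half_shift_prob:
  assumes n: "n > 0" and a: "a \<le> real n / 4" and B: "\<And>k. k \<in> B \<Longrightarrow> real n / 2 - a \<le> real k" and a0: "0 \<le> a"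
    and fin: "finite B"
  shows "measure_pmf.prob (binomial_pmf n (1/2)) ((\<lambda>k. k + L) ` B)
           \<le> exp (8 * a * L / n) * measure_pmf.prob (binomial_pmf n (1/2)) B"
proof -
  have "measure_pmf.prob (binomial_pmf n (1/2)) ((\<lambda>k. k + L) ` B) = (\<Sum>k\<in>B. pmf (binomial_pmf n (1/2)) (k + L))"
    using fin by (subst measure_measure_pmf_finite) (auto simp: sum.reindex simp del: pmf_binomial)
  also have "\<dots> \<le> (\<Sum>k\<in>B. exp (8 * a * L / n) * pmf (binomial_pmf n (1/2)) k)"
    by (intro sum_mono binomial_half_shift assms)
  also have "\<dots> = exp (8 * a * L / n) * measure_pmf.prob (binomial_pmf n (1/2)) B"
    using fin by (subst measure_measure_pmf_finite) (auto simp: sum_distrib_left simp del: pmf_binomial)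
  finally show ?thesis .
qed

text \<open>
  The disjoint translates of the window by \<open>g, 2 g, \<dots>, N g\<close> to the left carry nearly as much mass as
  the window itself, and all of them lie in \<open>{..s}\<close>; hence the window has at most a fraction of order
  \<open>1 / N\<close> of the mass to its left. This holds even in the tail, where the mass to the left is
  itself small.
\<close>

lemma binomial_half_window:
  assumes n: "n > 0" and a: "0 \<le> a" "a \<le> real n / 4" and g: "g > 0" and N: "N > 0"
    and s: "real n / 2 - a + real (N * g) \<le> real s"
  shows "measure_pmf.prob (binomial_pmf n (1/2)) {s<..s + g}
           \<le> exp (8 * a * real (N * g) / n) / N * measure_pmf.prob (binomial_pmf n (1/2)) {..s}"
proof -
  let ?P = "measure_pmf.prob (binomial_pmf n (1/2))"
  have a4: "N * g \<le> s"
  proof -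
    have "real (N * g) \<le> real s" using s a by linarith
    then show ?thesis by linarith
  qed
  define B where "B l = {s - l * g<..s + g - l * g}" for l
  have lg: "l * g \<le> N * g" if "l \<in> {1..N}" for l using that by simp
  have shift: "?P {s<..s + g} \<le> exp (8 * a * real (N * g) / n) * ?P (B l)" if l: "l \<in> {1..N}" for l
  proof -
    have ls: "l * g \<le> s" using lg[OF l] a4 by linarith
    have eq: "{s<..s + g} = (\<lambda>k. k + l * g) ` B l"
    proof (intro equalityI subsetI)
      fix k assume "k \<in> {s<..s + g}"
      then have "k - l * g \<in> B l" "k = (k - l * g) + l * g" using ls by (auto simp: B_def)
      then show "k \<in> (\<lambda>k. k + l * g) ` B l" by blast
    qed (use ls in \<open>auto simp: B_def\<close>)
    have le1: "?P ((\<lambda>k. k + l * g) ` B l) \<le> exp (8 * a * real (l * g) / n) * ?P (B l)"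
    proof (intro binomial_half_shift_prob n a)
      fix k assume "k \<in> B l"
      then have "s \<le> k + N * g" using lg[OF l] unfolding B_def greaterThanAtMost_iff by linarith
      then have "real s \<le> real k + real (N * g)" by (metis of_nat_add of_nat_mono)
      then show "real n / 2 - a \<le> real k" using s by linarith
    qed (auto simp: B_def)
    have le2: "exp (8 * a * real (l * g) / n) \<le> exp (8 * a * real (N * g) / n)"
    proof -
      have "real (l * g) \<le> real (N * g)" using lg[OF l] by (rule of_nat_mono)
      then show ?thesis using a by (auto intro!: divide_right_mono mult_left_mono)
    qed
    show ?thesis
      unfolding eq by (rule order_trans[OF le1 mult_right_mono[OF le2 measure_nonneg]])
  qed
  have disj: "disjoint_family_on B {1..N}"
    unfolding disjoint_family_on_def
  proof (intro ballI impI)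
    fix l l' assume l: "l \<in> {1..N}" "l' \<in> {1..N}" "l \<noteq> l'"
    have *: "B u \<inter> B v = {}" if "u < v" "u \<in> {1..N}" "v \<in> {1..N}" for u v
    proof -
      have "Suc u * g \<le> v * g" using that by (intro mult_right_mono) auto
      moreover have "v * g \<le> s" using lg[OF that(3)] a4 by linarith
      ultimately show ?thesis by (auto simp: B_def)
    qed
    show "B l \<inter> B l' = {}" using *[of l l'] *[of l' l] l by (cases l l' rule: linorder_cases) auto
  qed
  have "real N * ?P {s<..s + g} = (\<Sum>l\<in>{1..N}. ?P {s<..s + g})" by simp
  also have "\<dots> \<le> (\<Sum>l\<in>{1..N}. exp (8 * a * real (N * g) / n) * ?P (B l))" by (intro sum_mono shift)
  also have "\<dots> = exp (8 * a * real (N * g) / n) * ?P (\<Union>l\<in>{1..N}. B l)"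
    using disj by (subst measure_pmf.finite_measure_finite_Union) (auto simp: sum_distrib_left)
  also have "\<dots> \<le> exp (8 * a * real (N * g) / n) * ?P {..s}"
  proof (intro mult_left_mono measure_pmf.finite_measure_mono)
    show "(\<Union>l\<in>{1..N}. B l) \<subseteq> {..s}"
    proof safe
      fix l x assume l: "l \<in> {1..N}" "x \<in> B l"
      then have "1 * g \<le> l * g" by (intro mult_right_mono) auto
      with l(2) lg[OF l(1)] a4 show "x \<le> s"
        unfolding B_def greaterThanAtMost_iff by linarith
    qed
  qed auto
  finally show ?thesis using N by (simp add: field_simps)
qed

text \<open>
  The bulk of the law, whose mass Hoeffding's inequality bounds below, is moved \<open>L\<close> steps to the
  left at the price of the factor \<open>exp (8 a L / n)\<close>. Shifting the whole bulk rather than estimating a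
  single mass avoids losing a power of \<open>n\<close>.
\<close>

lemma binomial_half_lower_tail:
  assumes n: "n > 0" and a: "0 \<le> a" "a \<le> real n / 4" and bL: "0 \<le> b" "real L \<le> a"
  shows "exp (- (8 * a * real L / n)) *
            (1 - exp (- 2 * (a - L)\<^sup>2 / n) - exp (- 2 * b\<^sup>2 / n))
          \<le> measure_pmf.prob (binomial_pmf n (1/2)) {k. real k \<le> real n / 2 + b - L}"
proof -
  let ?P = "measure_pmf.prob (binomial_pmf n (1/2))"
  interpret binomial_distribution n "1/2" by unfold_locales auto
  define B where "B = {k. real n / 2 - a \<le> real k \<and> real k \<le> real n / 2 + b - L}"
  have finB: "finite B" by (rule finite_subset[of _ "{..nat \<lceil>real n / 2 + b\<rceil>}"]) (auto simp: B_def, linarith)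
  have sub: "UNIV \<subseteq> (\<lambda>k. k + L) ` B \<union> {k. real k \<le> real n * (1/2) - (a - L)} \<union> {k. real k \<ge> real n * (1/2) + b}"
  proof (intro subsetI UnCI)
    fix k :: nat
    assume "k \<notin> {k. real k \<ge> real n * (1/2) + b}" "k \<notin> {k. real k \<le> real n * (1/2) - (a - L)}"
    then have k: "real k < real n / 2 + b" "real k > real n / 2 - (a - L)" by auto
    have aL: "a \<le> real n / 2" using a by simp
    then have "real L < real k" using k by simp
    then have "k - L \<in> B" "k = (k - L) + L" using k by (auto simp: B_def of_nat_diff)
    then show "k \<in> (\<lambda>k. k + L) ` B" by blast
  qed
  have "1 = ?P UNIV" by simp
  also have "\<dots> \<le> ?P ((\<lambda>k. k + L) ` B \<union> {k. real k \<le> real n * (1/2) - (a - L)} \<union> {k. real k \<ge> real n * (1/2) + b})"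
    by (intro measure_pmf.finite_measure_mono sub) auto
  also have "\<dots> \<le> ?P ((\<lambda>k. k + L) ` B) + ?P {k. real k \<le> real n * (1/2) - (a - L)} + ?P {k. real k \<ge> real n * (1/2) + b}"
    by (rule order_trans[OF measure_Un_le add_right_mono[OF measure_Un_le]]) simp_all
  also have "\<dots> \<le> exp (8 * a * real L / n) * ?P B + exp (- 2 * (a - L)\<^sup>2 / n) + exp (- 2 * b\<^sup>2 / n)"
  proof (intro add_mono)
    show "?P ((\<lambda>k. k + L) ` B) \<le> exp (8 * a * real L / n) * ?P B"
      by (rule binomial_half_shift_prob[OF n a(2) _ a(1) finB]) (simp add: B_def)
    show "?P {k. real k \<le> real n * (1/2) - (a - L)} \<le> exp (- 2 * (a - L)\<^sup>2 / n)"
      by (rule prob_le[OF n]) (use bL in simp)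
    show "?P {k. real k \<ge> real n * (1/2) + b} \<le> exp (- 2 * b\<^sup>2 / n)"
      by (rule prob_ge[OF n]) (use bL in simp)
  qed
  finally have "1 - exp (- 2 * (a - L)\<^sup>2 / n) - exp (- 2 * b\<^sup>2 / n) \<le> exp (8 * a * real L / n) * ?P B"
    by simp
  then have "exp (- (8 * a * real L / n)) * (1 - exp (- 2 * (a - L)\<^sup>2 / n) - exp (- 2 * b\<^sup>2 / n))
     \<le> exp (- (8 * a * real L / n)) * (exp (8 * a * real L / n) * ?P B)"
    by (intro mult_left_mono) auto
  also have "\<dots> = ?P B" by (simp add: exp_minus)
  also have "\<dots> \<le> ?P {k. real k \<le> real n / 2 + b - L}"
    by (intro measure_pmf.finite_measure_mono) (auto simp: B_def)
  finally show ?thesis .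
qed

section \<open>Near ties at the minimum of independent variables\<close>

text \<open>
  Conditioning on all coordinates but one: a comparison of two events that holds for the law of the
  coordinate \<open>j\<close>, whatever the other coordinates are, holds for the product law.
\<close>

lemma Pi_pmf_prob_le_by_coordinate:
  assumes J: "finite J" and j: "j \<in> J" and e: "\<epsilon> \<ge> 0"
    and le: "\<And>f. measure_pmf.prob (p j) {y. f(j := y) \<in> E} \<le> \<epsilon> * measure_pmf.prob (p j) {y. f(j := y) \<in> W}"
  shows "measure_pmf.prob (Pi_pmf J d p) E \<le> \<epsilon> * measure_pmf.prob (Pi_pmf J d p) W"
proof -
  have ins: "J = insert j (J - {j})" using j by auto
  have law: "Pi_pmf J d p = bind_pmf (Pi_pmf (J - {j}) d p) (\<lambda>f. map_pmf (\<lambda>y. f(j := y)) (p j))"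
    using J by (subst ins, subst Pi_pmf_insert') (auto simp: map_pmf_def bind_commute_pmf[of "p j"])
  have em: "emeasure (Pi_pmf J d p) B = (\<integral>\<^sup>+f. emeasure (p j) {y. f(j := y) \<in> B} \<partial>Pi_pmf (J - {j}) d p)" for B
    unfolding law by (simp add: vimage_def)
  have "emeasure (Pi_pmf J d p) E \<le> (\<integral>\<^sup>+f. ennreal \<epsilon> * emeasure (p j) {y. f(j := y) \<in> W} \<partial>Pi_pmf (J - {j}) d p)"
    unfolding em using le e
    by (intro nn_integral_mono) (simp add: measure_pmf.emeasure_eq_measure ennreal_mult[symmetric] ennreal_leI)
  also have "\<dots> = ennreal \<epsilon> * emeasure (Pi_pmf J d p) W"
    unfolding em by (rule nn_integral_cmult) auto
  finally show ?thesis
    using e by (simp add: measure_pmf.emeasure_eq_measure ennreal_mult[symmetric])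
qed

text \<open>
  Given the other variables, with minimum \<open>t\<close>, the variable \<open>j\<close> is a minimiser with lead less than
  \<open>g\<close> exactly when it lies in the window \<open>{t - g<..t}\<close>. The hypothesis bounds the probability of
  this by \<open>\<epsilon>\<close> times the probability that \<open>j\<close> is at most \<open>t - g\<close> and so is the strict minimiser. At
  most one index is the strict minimiser, so the sum over \<open>j\<close> costs nothing.
\<close>

lemma near_tie_prob:
  fixes q :: "nat pmf"
  assumes J: "finite J" and g: "g \<ge> 1" and e: "\<epsilon> \<ge> 0"
    and window: "\<And>s. s \<ge> s0 \<Longrightarrow> measure_pmf.prob q {s<..s + g} \<le> \<epsilon> * measure_pmf.prob q {..s}"
  shows "measure_pmf.prob (Pi_pmf J d (\<lambda>_. q))
           {c. \<exists>j\<in>J. (\<forall>i\<in>J - {j}. s0 + g \<le> c i \<and> c j \<le> c i) \<and> (\<exists>i\<in>J - {j}. c i < c j + g)} \<le> \<epsilon>"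
proof -
  let ?P = "Pi_pmf J d (\<lambda>_. q)"
  define E where "E j = {c. (\<forall>i\<in>J - {j}. s0 + g \<le> c i \<and> c j \<le> c i) \<and> (\<exists>i\<in>J - {j}. c i < c j + g)}" for j
  define W where "W j = {c :: 'a \<Rightarrow> nat. \<forall>i\<in>J - {j}. c j < c i}" for j
  have EW: "measure_pmf.prob ?P (E j) \<le> \<epsilon> * measure_pmf.prob ?P (W j)" if j: "j \<in> J" for j
  proof (rule Pi_pmf_prob_le_by_coordinate[OF J j e])
    fix f :: "'a \<Rightarrow> nat"
    show "measure_pmf.prob q {y. f(j := y) \<in> E j} \<le> \<epsilon> * measure_pmf.prob q {y. f(j := y) \<in> W j}"
    proof (cases "J - {j} \<noteq> {} \<and> (\<forall>i\<in>J - {j}. s0 + g \<le> f i)")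
      case True
      define s where "s = Min (f ` (J - {j})) - g"
      have fin: "finite (f ` (J - {j}))" and ne: "f ` (J - {j}) \<noteq> {}" using J True by auto
      have "Min (f ` (J - {j})) \<in> f ` (J - {j})" using fin ne by (rule Min_in)
      then have Mg: "s0 + g \<le> Min (f ` (J - {j}))" using True by auto
      then have s: "s \<ge> s0" "Min (f ` (J - {j})) = s + g" by (auto simp: s_def)
      have le: "s + g \<le> f i" if "i \<in> J - {j}" for i
        using that fin s(2) by (metis Min_le imageI)
      have "measure_pmf.prob q {y. f(j := y) \<in> E j} \<le> measure_pmf.prob q {s<..s + g}"
      proof (intro measure_pmf.finite_measure_mono subsetI)
        fix y assume "y \<in> {y. f(j := y) \<in> E j}"
        then have *: "\<forall>i\<in>J - {j}. y \<le> f i" "\<exists>i\<in>J - {j}. f i < y + g" by (auto simp: E_def)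
        from *(1) have "y \<le> Min (f ` (J - {j}))" using fin ne by auto
        moreover from *(2) have "Min (f ` (J - {j})) < y + g" using fin by (meson Min_le imageI le_less_trans)
        ultimately show "y \<in> {s<..s + g}" using s by auto
      qed auto
      also have "\<dots> \<le> \<epsilon> * measure_pmf.prob q {..s}" by (rule window[OF s(1)])
      also have "\<dots> \<le> \<epsilon> * measure_pmf.prob q {y. f(j := y) \<in> W j}"
        using le g by (intro mult_left_mono e measure_pmf.finite_measure_mono) (fastforce simp: W_def)+
      finally show ?thesis .
    next
      case False
      then have "{y. f(j := y) \<in> E j} = {}" by (auto simp: E_def)
      then show ?thesis using e by simp
    qed
  qed
  have "{c. \<exists>j\<in>J. (\<forall>i\<in>J - {j}. s0 + g \<le> c i \<and> c j \<le> c i) \<and> (\<exists>i\<in>J - {j}. c i < c j + g)} = (\<Union>j\<in>J. E j)"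
    by (auto simp: E_def)
  then have "measure_pmf.prob ?P {c. \<exists>j\<in>J. (\<forall>i\<in>J - {j}. s0 + g \<le> c i \<and> c j \<le> c i) \<and> (\<exists>i\<in>J - {j}. c i < c j + g)}
        \<le> (\<Sum>j\<in>J. measure_pmf.prob ?P (E j))"
    using J by (simp add: measure_pmf.finite_measure_subadditive_finite)
  also have "\<dots> \<le> (\<Sum>j\<in>J. \<epsilon> * measure_pmf.prob ?P (W j))" by (intro sum_mono EW)
  also have "\<dots> = \<epsilon> * (\<Sum>j\<in>J. measure_pmf.prob ?P (W j))" by (simp add: sum_distrib_left)
  also have "(\<Sum>j\<in>J. measure_pmf.prob ?P (W j)) = measure_pmf.prob ?P (\<Union>j\<in>J. W j)"
  proof (intro measure_pmf.finite_measure_finite_Union[symmetric] J)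
    have "c j < c i \<and> c i < c j" if "c \<in> W i" "c \<in> W j" "i \<in> J" "j \<in> J" "i \<noteq> j" for c i j
      using that unfolding W_def by blast
    then show "disjoint_family_on W J"
      unfolding disjoint_family_on_def by (meson disjoint_iff less_asym)
  qed auto
  also have "\<epsilon> * \<dots> \<le> \<epsilon>" using e by (simp add: mult_left_le)
  finally show ?thesis .
qed

text \<open>
  If the minimum is not separated by \<open>g\<close> or does not reach \<open>\<tau>\<close>, then some variable is below
  \<open>s0 + g\<close>, where the window hypothesis says nothing, or there is a near tie at the minimum, or all
  variables exceed \<open>\<tau>\<close>.
\<close>

lemma separated_minimum_failure:
  fixes q :: "nat pmf" and \<tau> :: real
  assumes J: "finite J" and g: "g \<ge> 1" and e: "\<epsilon> \<ge> 0"
    and window: "\<And>s. s \<ge> s0 \<Longrightarrow> measure_pmf.prob q {s<..s + g} \<le> \<epsilon> * measure_pmf.prob q {..s}"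
  shows "measure_pmf.prob (Pi_pmf J d (\<lambda>_. q))
           {c. \<not> (\<exists>j\<in>J. (\<forall>i\<in>J - {j}. c j + g \<le> c i) \<and> real (c j) \<le> \<tau>)}
         \<le> card J * measure_pmf.prob q {..<s0 + g} + \<epsilon> + (1 - measure_pmf.prob q {k. real k \<le> \<tau>}) ^ card J"
proof -
  let ?P = "measure_pmf.prob (Pi_pmf J d (\<lambda>_. q))"
  define A1 where "A1 = (\<Union>i\<in>J. {c. c i < s0 + g})"
  define A2 where "A2 = {c. \<exists>j\<in>J. (\<forall>i\<in>J - {j}. s0 + g \<le> c i \<and> c j \<le> c i) \<and> (\<exists>i\<in>J - {j}. c i < c j + g)}"
  define A3 where "A3 = (Pi J (\<lambda>_. - {k. real k \<le> \<tau>}))"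
  have "{c. \<not> (\<exists>j\<in>J. (\<forall>i\<in>J - {j}. c j + g \<le> c i) \<and> real (c j) \<le> \<tau>)} \<subseteq> A1 \<union> A2 \<union> A3"
  proof (intro subsetI UnCI)
    fix c assume c: "c \<in> {c. \<not> (\<exists>j\<in>J. (\<forall>i\<in>J - {j}. c j + g \<le> c i) \<and> real (c j) \<le> \<tau>)}"
      and n3: "c \<notin> A3" and n2: "c \<notin> A2"
    obtain i where i: "i \<in> J" "real (c i) \<le> \<tau>" using n3 by (auto simp: A3_def)
    define j where "j = arg_min_on c J"
    have j: "j \<in> J" and jm: "\<And>i. i \<in> J \<Longrightarrow> c j \<le> c i"
      using arg_min_if_finite[of J c] i(1) J unfolding j_def by (auto simp: not_less)
    have "real (c j) \<le> \<tau>" using jm[OF i(1)] i(2) by linarith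
    then have "\<not> (\<forall>i\<in>J - {j}. c j + g \<le> c i)" using c j by blast
    then obtain i' where i': "i' \<in> J - {j}" "c i' < c j + g" by (auto simp: not_le)
    show "c \<in> A1"
    proof (rule ccontr)
      assume "c \<notin> A1"
      then have "\<forall>i\<in>J - {j}. s0 + g \<le> c i \<and> c j \<le> c i" using jm by (auto simp: A1_def not_less)
      then have "c \<in> A2" using j i' unfolding A2_def by blast
      with n2 show False ..
    qed
  qed
  then have "?P {c. \<not> (\<exists>j\<in>J. (\<forall>i\<in>J - {j}. c j + g \<le> c i) \<and> real (c j) \<le> \<tau>)} \<le> ?P (A1 \<union> A2 \<union> A3)"
    by (intro measure_pmf.finite_measure_mono) auto
  also have "\<dots> \<le> ?P A1 + ?P A2 + ?P A3"
    by (rule order_trans[OF measure_Un_le add_right_mono[OF measure_Un_le]]) simp_all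
  also have "?P A1 \<le> (\<Sum>i\<in>J. ?P {c. c i < s0 + g})"
    unfolding A1_def using J by (intro measure_pmf.finite_measure_subadditive_finite) auto
  also have "\<dots> = (\<Sum>i\<in>J. measure_pmf.prob q {..<s0 + g})"
  proof (rule sum.cong[OF refl])
    fix i assume i: "i \<in> J"
    have "measure_pmf.prob q {..<s0 + g} = measure_pmf.prob (map_pmf (\<lambda>c. c i) (Pi_pmf J d (\<lambda>_. q))) {..<s0 + g}"
      using J i by (subst Pi_pmf_component) simp_all
    then show "?P {c. c i < s0 + g} = measure_pmf.prob q {..<s0 + g}" by (simp add: vimage_def)
  qed
  also have "?P A2 \<le> \<epsilon>"
    unfolding A2_def by (rule near_tie_prob[OF J g e window])
  also have "?P A3 = (1 - measure_pmf.prob q {k. real k \<le> \<tau>}) ^ card J"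
    unfolding A3_def using J
    using measure_pmf.prob_compl[of "{k. real k \<le> \<tau>}" q]
    by (simp add: measure_Pi_pmf_Pi Compl_eq_Diff_UNIV)
  finally show ?thesis by simp
qed

section \<open>The separated minimum of many binomial variables\<close>

text \<open>
  The lead in cumulated empirical loss that the weights turn into a factor \<open>n powr (- 2 / T)\<close>.
\<close>

definition gap :: "nat \<Rightarrow> nat" where "gap n = nat \<lceil>2 * ln (real n)\<rceil>"

text \<open>
  The excess risk of the bad predictors over the oracle. The factor \<open>1 / 192\<close> is small enough for a
  fair binomial variable to fall below its mean by more than \<open>n * excess n\<close> with probability at
  least of order \<open>n powr (- 1/4)\<close>, so that among \<open>sqrt n\<close> independent copies this is almost certain
  to happen.
\<close>

definition excess :: "nat \<Rightarrow> real" where "excess n = sqrt (ln (real n) / real n) / 192"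

text \<open>
  The three failure probabilities of \<open>separated_minimum_failure\<close> are at most \<open>1 / n\<close> by Hoeffding's
  inequality, of order \<open>ln n * sqrt (ln n / n)\<close> by the window estimate, and at most
  \<open>exp (- (n powr (1/4)) / 2)\<close> by the lower tail estimate. All of them are negligible against
  \<open>n powr (\<alpha> - 1/2)\<close>; the exponent \<open>\<alpha>\<close> only absorbs logarithms.
\<close>

lemma separated_minimum_prob:
  assumes \<alpha>: "\<alpha> > 0"
  shows "eventually (\<lambda>n. \<forall>J :: nat set. finite J \<and> sqrt (real n) \<le> card J \<and> card J \<le> n \<longrightarrow>
           measure_pmf.prob (Pi_pmf J d (\<lambda>_. binomial_pmf n (1/2)))
             {c. \<not> (\<exists>j\<in>J. (\<forall>i\<in>J - {j}. c j + gap n \<le> c i) \<and>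
                          real (c j) \<le> n * (1/2 - excess n) - gap n)} \<le> real n powr (\<alpha> - 1/2)) sequentially"
proof -
  \<comment> \<open>\<open>r n\<close> is the scale of the minimum: by Hoeffding's inequality a binomial variable falls
     below \<open>n / 2 - r n\<close> with probability at most \<open>1 / n\<^sup>2\<close>.\<close>
  define r where "r x = sqrt (x * ln x)" for x :: real
  have l0: "eventually (\<lambda>x::real. 2 * r x \<le> x / 4) at_top"
    unfolding r_def using \<alpha> by real_asymp
  have l1: "eventually (\<lambda>x::real. x / r x + 2 + 3 * ln x \<le> r x) at_top"
    unfolding r_def using \<alpha> by real_asymp
  have l2: "eventually (\<lambda>x::real. 3 * ln x \<le> r x / 384) at_top"
    unfolding r_def using \<alpha> by real_asymp
  have l3: "eventually (\<lambda>x::real. 192 \<le> r x) at_top"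
    unfolding r_def using \<alpha> by real_asymp
  have l4: "eventually (\<lambda>x::real. x powr (-2) + x powr (-1/73728) \<le> 1/2) at_top"
    unfolding r_def using \<alpha> by real_asymp
  have l5: "eventually (\<lambda>x::real. 6 * r x * ln x \<le> x) at_top"
    unfolding r_def using \<alpha> by real_asymp
  have l6: "eventually (\<lambda>x::real. 1 \<le> ln x) at_top"
    unfolding r_def using \<alpha> by real_asymp
  have l7: "eventually (\<lambda>x::real. 1 \<le> x) at_top"
    unfolding r_def using \<alpha> by real_asymp
  have l8: "eventually (\<lambda>x::real. 1 / x + 6 * exp 16 * r x * ln x / x + exp (- (x powr (1/4) / 2)) \<le> x powr (\<alpha> - 1/2)) at_top"
    unfolding r_def using \<alpha> by real_asymp
  have ev: "eventually (\<lambda>x. 2 * r x \<le> x / 4 \<and> x / r x + 2 + 3 * ln x \<le> r x \<and> 3 * ln x \<le> r x / 384 \<and>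
       192 \<le> r x \<and> x powr (-2) + x powr (-1/73728) \<le> 1/2 \<and> 6 * r x * ln x \<le> x \<and>
       1 \<le> ln x \<and> 1 \<le> x \<and>
       1 / x + 6 * exp 16 * r x * ln x / x + exp (- (x powr (1/4) / 2)) \<le> x powr (\<alpha> - 1/2)) at_top"
    by (intro eventually_conj l0 l1 l2 l3 l4 l5 l6 l7 l8)
  show ?thesis
  proof (rule eventually_mono[OF eventually_compose_filterlim[OF ev filterlim_real_sequentially]], intro allI impI)
    fix n :: nat and J :: "nat set"
    define x where "x = real n"
    define g where "g = gap n"
    define c :: real where "c = 1/192"
    assume "2 * r (real n) \<le> real n / 4 \<and> real n / r (real n) + 2 + 3 * ln (real n) \<le> r (real n) \<and> 3 * ln (real n) \<le> r (real n) / 384 \<and>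
       192 \<le> r (real n) \<and> real n powr (-2) + real n powr (-1/73728) \<le> 1/2 \<and> 6 * r (real n) * ln (real n) \<le> real n \<and>
       1 \<le> ln (real n) \<and> 1 \<le> real n \<and>
       1 / real n + 6 * exp 16 * r (real n) * ln (real n) / real n + exp (- (real n powr (1/4) / 2)) \<le> real n powr (\<alpha> - 1/2)"
    then have e1: "2 * r x \<le> x / 4" and e2: "x / r x + 2 + 3 * ln x \<le> r x" and e3: "3 * ln x \<le> r x / 384"
      and e4: "192 \<le> r x" and e5: "x powr (-2) + x powr (-1/73728) \<le> 1/2"
      and e6: "6 * r x * ln x \<le> x" and e7: "1 \<le> ln x" and e8: "1 \<le> x"
      and e9: "1 / x + 6 * exp 16 * r x * ln x / x + exp (- (x powr (1/4) / 2)) \<le> x powr (\<alpha> - 1/2)"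
      by (auto simp: x_def)
    assume J: "finite J \<and> sqrt (real n) \<le> card J \<and> card J \<le> n"
    let ?P = "measure_pmf.prob (binomial_pmf n (1/2))"
    interpret binomial_distribution n "1/2" by unfold_locales auto
    have n: "n > 0" and x0: "x > 0" using e8 by (auto simp: x_def)
    have r2: "(r x)\<^sup>2 = x * ln x" using e7 e8 by (simp add: r_def)
    have rr: "r x * r x = x * ln x" using r2 by (simp add: power2_eq_square)
    have r0: "r x > 0" using e4 by simp
    have g1: "2 * ln x \<le> real g" "real g \<le> 3 * ln x" "g \<ge> 1"
      using e7 by (auto simp: g_def gap_def x_def) linarith+
    have rg: "2 * (r x * g) \<le> x"
    proof -
      have "r x * g \<le> r x * (3 * ln x)" using g1(2) r0 by (intro mult_left_mono) auto
      then show ?thesis using e6 by simp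
    qed
    have rg0: "r x * g > 0" using r0 g1 by simp
    \<comment> \<open>The number \<open>N\<close> of translates is as large as possible while the total shift \<open>N * g\<close> stays
       below \<open>n / r n\<close>, where shifted masses change by at most the constant factor \<open>exp 16\<close>.\<close>
    define y where "y = x / (r x * g)"
    define N where "N = nat \<lfloor>y\<rfloor>"
    have y2: "2 \<le> y" using rg rg0 by (simp add: y_def field_simps)
    have N1: "real N \<le> y" and N2: "y / 2 \<le> real N" and N0: "N > 0"
      unfolding N_def using y2 by linarith+
    have yg: "y * g = x / r x" using g1 by (simp add: y_def)
    have Ng: "real (N * g) \<le> x / r x"
      using mult_right_mono[OF N1, of "real g"] by (simp add: yg)
    define s0 where "s0 = nat \<lceil>x / 2 - 2 * r x + real (N * g)\<rceil>"
    define \<epsilon> where "\<epsilon> = exp 16 / real N"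
    have window: "?P {s<..s + g} \<le> \<epsilon> * ?P {..s}" if "s \<ge> s0" for s
    proof -
      have "x / 2 - 2 * r x + real (N * g) \<le> real s0" unfolding s0_def by linarith
      then have s: "real n / 2 - 2 * r x + real (N * g) \<le> real s" using that unfolding x_def by linarith
      have "?P {s<..s + g} \<le> exp (8 * (2 * r x) * real (N * g) / n) / N * ?P {..s}"
        using e1 r0 g1 by (intro binomial_half_window n N0 s) (auto simp: x_def)
      also have "8 * (2 * r x) * real (N * g) / n \<le> 16"
        using mult_left_mono[OF Ng, of "r x"] r0 x0 by (simp add: x_def[symmetric] field_simps)
      then have "exp (8 * (2 * r x) * real (N * g) / n) / N * ?P {..s} \<le> \<epsilon> * ?P {..s}"
        unfolding \<epsilon>_def by (intro mult_right_mono divide_right_mono) auto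
      finally show ?thesis .
    qed
    have tail: "?P {..<s0 + g} \<le> 1 / x\<^sup>2"
    proof -
      have "real s0 \<le> x / 2 - 2 * r x + real (N * g) + 1"
        unfolding s0_def using e1 x0 by linarith
      then have sg: "real s0 + real g \<le> x / 2 - r x" using Ng g1 e2 by linarith
      have "?P {..<s0 + g} \<le> ?P {k. real k \<le> real n * (1/2) - r x}"
      proof (intro measure_pmf.finite_measure_mono subsetI)
        fix k assume "k \<in> {..<s0 + g}"
        then have "real k \<le> real s0 + real g" by simp
        then show "k \<in> {k. real k \<le> real n * (1/2) - r x}" using sg by (simp add: x_def)
      qed auto
      also have "\<dots> \<le> exp (- 2 * (r x)\<^sup>2 / n)" using r0 by (intro prob_le n) simp
      also have "- 2 * (r x)\<^sup>2 / n = - ln (x\<^sup>2)" 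
        using x0 by (simp add: r2 x_def[symmetric] ln_realpow)
      also have "exp (- ln (x\<^sup>2)) = 1 / x\<^sup>2" using x0 by (simp add: exp_minus field_simps)
      finally show ?thesis .
    qed
    define \<tau> where "\<tau> = n * (1/2 - excess n) - gap n"
    have \<tau>: "\<tau> = x / 2 - c * r x - g"
    proof -
      have "x * sqrt (ln x / x) = r x"
        using x0 e7 unfolding r_def by (simp add: real_sqrt_divide real_sqrt_mult field_simps)
      then show ?thesis by (simp add: \<tau>_def excess_def x_def[symmetric] g_def c_def algebra_simps)
    qed
    have low: "x powr (-1/4) / 2 \<le> ?P {k. real k \<le> \<tau>}"
    proof -
      \<comment> \<open>Half of this shift leads from the mean to the loss of the oracle; the other half pays for
         the lead \<open>g\<close> and for room above the mean, which the bulk needs.\<close>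
      define L where "L = nat \<lceil>2 * c * r x\<rceil>"
      have L: "2 * c * r x \<le> real L" "real L \<le> 3 * c * r x"
        unfolding L_def using e4 by (auto simp: c_def) linarith+
      have Lr: "real L \<le> r x" using L(2) r0 by (simp add: c_def)
      have ex1: "exp (- (8 * (2 * r x) * L / n)) \<ge> x powr (-1/4)"
      proof -
        have "r x * real L \<le> r x * (3 * c * r x)" using L r0 by (intro mult_left_mono) auto
        also have "\<dots> = x * ln x / 64" using rr by (simp add: c_def)
        finally have "8 * (2 * r x) * L / n \<le> ln x / 4" using x0 by (simp add: x_def[symmetric] field_simps)
        then show ?thesis using x0 by (simp add: powr_def)
      qed
      have ex2: "exp (- 2 * (2 * r x - L)\<^sup>2 / n) \<le> x powr (-2)"
      proof -
        have "x * ln x \<le> (2 * r x - L)\<^sup>2" unfolding r2[symmetric] using Lr r0 by (intro power_mono) auto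
        then show ?thesis using x0 by (simp add: powr_def x_def[symmetric] field_simps)
      qed
      have ex3: "exp (- 2 * (c * r x / 2)\<^sup>2 / n) = x powr (-1/73728)"
        using x0 r2 by (simp add: powr_def x_def[symmetric] c_def power_divide power_mult_distrib)
      have "x powr (-1/4) * (1/2) \<le> exp (- (8 * (2 * r x) * L / n)) *
            (1 - exp (- 2 * (2 * r x - L)\<^sup>2 / n) - exp (- 2 * (c * r x / 2)\<^sup>2 / n))"
      proof (rule mult_mono[OF ex1])
        show "1/2 \<le> 1 - exp (- 2 * (2 * r x - L)\<^sup>2 / n) - exp (- 2 * (c * r x / 2)\<^sup>2 / n)"
          using ex2 e5 unfolding ex3 by linarith
      qed simp_all
      also have "\<dots> \<le> ?P {k. real k \<le> real n / 2 + c * r x / 2 - L}"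
        using e1 r0 Lr by (intro binomial_half_lower_tail n) (auto simp: x_def c_def)
      also have "\<dots> \<le> ?P {k. real k \<le> \<tau>}"
        using L(1) e3 g1 r0 unfolding \<tau>
        by (intro measure_pmf.finite_measure_mono) (auto simp: x_def[symmetric] c_def)
      finally show ?thesis by simp
    qed
    have "measure_pmf.prob (Pi_pmf J d (\<lambda>_. binomial_pmf n (1/2)))
             {c. \<not> (\<exists>j\<in>J. (\<forall>i\<in>J - {j}. c j + g \<le> c i) \<and> real (c j) \<le> \<tau>)}
          \<le> card J * ?P {..<s0 + g} + \<epsilon> + (1 - ?P {k. real k \<le> \<tau>}) ^ card J"
      using J g1 by (intro separated_minimum_failure window) (auto simp: \<epsilon>_def)
    also have "card J * ?P {..<s0 + g} \<le> x * (1 / x\<^sup>2)"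
      using J by (intro mult_mono tail) (auto simp: x_def)
    also have "x * (1 / x\<^sup>2) = 1 / x" by (simp add: power2_eq_square)
    also have "\<epsilon> \<le> 6 * exp 16 * r x * ln x / x"
    proof -
      have "\<epsilon> \<le> exp 16 / (y / 2)"
        unfolding \<epsilon>_def using N2 y2 by (intro divide_left_mono) auto
      also have "\<dots> = 2 * exp 16 * r x * g / x" by (simp add: y_def)
      also have "\<dots> \<le> 2 * exp 16 * r x * (3 * ln x) / x"
        using g1 r0 x0 by (intro divide_right_mono mult_left_mono) auto
      finally show ?thesis by simp
    qed
    also have "(1 - ?P {k. real k \<le> \<tau>}) ^ card J \<le> exp (- (x powr (1/4) / 2))"
    proof -
      have "(1 - ?P {k. real k \<le> \<tau>}) ^ card J \<le> exp (- ?P {k. real k \<le> \<tau>}) ^ card J"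
        using exp_ge_add_one_self[of "- ?P {k. real k \<le> \<tau>}"] by (intro power_mono) auto
      also have "\<dots> = exp (- (card J * ?P {k. real k \<le> \<tau>}))"
        by (simp add: exp_of_nat_mult[symmetric])
      also have "\<dots> \<le> exp (- (x powr (1/4) / 2))"
      proof -
        have "x powr (1/4) / 2 = x powr (1/2) * (x powr (-1/4) / 2)"
          by (simp add: powr_add[symmetric])
        also have "\<dots> \<le> card J * ?P {k. real k \<le> \<tau>}"
          using J x0 low by (intro mult_mono) (auto simp: powr_half_sqrt x_def)
        finally show ?thesis by simp
      qed
      finally show ?thesis .
    qed
    also note e9
    finally show "measure_pmf.prob (Pi_pmf J d (\<lambda>_. binomial_pmf n (1/2)))
             {c. \<not> (\<exists>j\<in>J. (\<forall>i\<in>J - {j}. c j + gap n \<le> c i) \<and>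
                          real (c j) \<le> n * (1/2 - excess n) - gap n)} \<le> real n powr (\<alpha> - 1/2)"
      by (simp add: g_def \<tau>_def x_def)
  qed
qed

section \<open>Exponential weights when one predictor leads\<close>

text \<open>
  Every competitor has at most \<open>exp (- g / T)\<close> times the unnormalised weight of the leader.
\<close>

lemma aew_weight_ge:
  assumes F: "finite F" and f: "f \<in> F" and T: "T > 0"
    and gap: "\<And>h. h \<in> F - {f} \<Longrightarrow> real n * emp_risk n D f + g \<le> real n * emp_risk n D h"
  shows "aew_weight n T F D f \<ge> 1 - card F * exp (- g / T)"
proof -
  define e where "e h = exp (- (real n / T) * emp_risk n D h)" for h
  have e0: "e h > 0" for h by (simp add: e_def)
  have le: "e h \<le> exp (- g / T) * e f" if "h \<in> F - {f}" for h
    using gap[OF that] T by (simp add: e_def exp_add[symmetric] field_simps)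
  have Z: "sum e F = e f + sum e (F - {f})" using F f by (rule sum.remove)
  have "sum e (F - {f}) \<le> card (F - {f}) * (exp (- g / T) * e f)"
    using sum_bounded_above[of "F - {f}" e, OF le] by simp
  also have "\<dots> \<le> card F * (exp (- g / T) * e f)"
    using F e0[of f] by (intro mult_right_mono) (auto intro: card_mono)
  finally have rest: "sum e (F - {f}) \<le> card F * exp (- g / T) * e f" by simp
  have rest0: "0 \<le> sum e (F - {f})" using e0 by (intro sum_nonneg) (auto intro: less_imp_le)
  have "(1 - card F * exp (- g / T)) * sum e F \<le> e f"
  proof -
    have "sum e F * 1 \<le> e f + card F * exp (- g / T) * e f" using Z rest by simp
    also have "\<dots> \<le> e f + card F * exp (- g / T) * sum e F"
      using Z rest0 by (intro add_left_mono mult_left_mono) auto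
    finally show ?thesis by (simp add: algebra_simps)
  qed
  then have "1 - card F * exp (- g / T) \<le> e f / sum e F"
    using Z rest0 e0[of f] by (subst pos_le_divide_eq) auto
  then show ?thesis by (simp add: aew_weight_def e_def)
qed

lemma aew_ge_single:
  assumes F: "finite F" and f: "f \<in> F" and nn: "\<And>h. h \<in> F \<Longrightarrow> 0 \<le> h x"
  shows "aew n T F D x \<ge> aew_weight n T F D f * f x"
proof -
  have "0 \<le> aew_weight n T F D h" for h
    by (auto simp: aew_weight_def intro!: divide_nonneg_nonneg sum_nonneg)
  then show ?thesis
    unfolding aew_def using F f nn
    by (intro member_le_sum[where f = "\<lambda>h. aew_weight n T F D h * h x"]) auto
qed

section \<open>The coin design\<close>

text \<open>
  The input is a vector of \<open>m\<close> independent fair bits, padded with zeros; the second component only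
  fills the type of the sample space.
\<close>

definition coin_design :: "nat \<Rightarrow> ((nat \<Rightarrow> real) \<times> real) pmf" where
  "coin_design m = map_pmf (\<lambda>b. (\<lambda>j. of_bool (b j), 0)) (Pi_pmf {..<m} False (\<lambda>_. bernoulli_pmf (1/2)))"

definition coord :: "nat \<Rightarrow> (nat \<Rightarrow> real) \<Rightarrow> real" where
  "coord j = (\<lambda>x. x j)"

text \<open>
  As the response is \<open>0\<close>, the loss of this constant is the number \<open>1/2 - excess n\<close> whenever
  \<open>excess n \<le> 1/2\<close>: the oracle has no fluctuation at all.
\<close>

definition const_pred :: "nat \<Rightarrow> (nat \<Rightarrow> real) \<Rightarrow> real" where
  "const_pred n = (\<lambda>_. sqrt (1/2 - excess n))"

definition coin_dictionary :: "nat \<Rightarrow> nat \<Rightarrow> ((nat \<Rightarrow> real) \<Rightarrow> real) set" where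
  "coin_dictionary n m = insert (const_pred n) (coord ` {..<m})"

abbreviation (input) design_risk :: "nat \<Rightarrow> ((nat \<Rightarrow> real) \<Rightarrow> real) \<Rightarrow> real" where
  "design_risk m \<equiv> risk (measure_pmf (coin_design m)) fst (\<lambda>_. 0)"

lemma coord_neq_const: "coord j \<noteq> const_pred n"
proof
  assume "coord j = const_pred n"
  from fun_cong[OF this, of "\<lambda>_. 0"] fun_cong[OF this, of "\<lambda>_. 1"] show False
    by (simp add: coord_def const_pred_def)
qed

lemma inj_coord: "inj coord"
proof (rule injI)
  fix i j assume "coord i = coord j"
  from fun_cong[OF this, of "\<lambda>k. of_bool (k = i)"] show "i = j"
    by (simp add: coord_def split: if_splits)
qed

lemma card_coin_dictionary: "card (coin_dictionary n m) = Suc m"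
  unfolding coin_dictionary_def
  by (subst card_insert_disjoint) (auto simp: coord_neq_const[symmetric] card_image inj_on_subset[OF inj_coord])

lemma finite_coin_dictionary: "finite (coin_dictionary n m)"
  by (simp add: coin_dictionary_def)

lemma coin_design_bool:
  assumes "\<omega> \<in> set_pmf (coin_design m)"
  shows "fst \<omega> j \<in> {0, 1}"
  using assms by (auto simp: coin_design_def)

lemma finite_set_coin_design: "finite (set_pmf (coin_design m))"
  unfolding coin_design_def set_map_pmf
  by (intro finite_imageI finite_subset[OF set_Pi_pmf_subset'] finite_PiE_dflt) auto

lemma risk_const: "excess n \<le> 1/2 \<Longrightarrow> design_risk m (const_pred n) = 1/2 - excess n"
  by (simp add: risk_def quad_loss_def const_pred_def)

lemma risk_coord:
  assumes "j < m"
  shows "design_risk m (coord j) = 1/2"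
proof -
  let ?Q = "Pi_pmf {..<m} False (\<lambda>_. bernoulli_pmf (1/2))"
  have "design_risk m (coord j) = measure_pmf.expectation ?Q (\<lambda>b. of_bool (b j))"
    by (simp add: risk_def quad_loss_def coord_def coin_design_def)
       (intro Bochner_Integration.integral_cong, auto)
  also have "\<dots> = measure_pmf.expectation (map_pmf (\<lambda>b. b j) ?Q) of_bool"
    by simp
  also have "map_pmf (\<lambda>b. b j) ?Q = bernoulli_pmf (1/2)"
    using assms by (subst Pi_pmf_component) auto
  finally show ?thesis by simp
qed

lemma dictionary_coin: "dictionary (count_space UNIV) (coin_dictionary n m)"
  by (auto simp: dictionary_def finite_coin_dictionary extensional_def)

lemma coin_dictionary_range:
  assumes "excess n \<le> 1/2" "h \<in> coin_dictionary n m" "\<omega> \<in> set_pmf (coin_design m)"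
  shows "0 \<le> h (fst \<omega>)" "(h (fst \<omega>))\<^sup>2 \<le> 1"
proof -
  have e0: "0 \<le> excess n" by (cases "n = 0") (simp_all add: excess_def)
  have "h (fst \<omega>) = sqrt (1/2 - excess n) \<or> h (fst \<omega>) \<in> {0, 1}"
    using assms(2) coin_design_bool[OF assms(3)]
    unfolding coin_dictionary_def coord_def const_pred_def by blast
  then show "0 \<le> h (fst \<omega>)" "(h (fst \<omega>))\<^sup>2 \<le> 1"
    using assms(1) e0 by auto
qed

text \<open>
  All predictors are nonnegative on the support of the design and the response is \<open>0\<close>, so the other
  predictors can only increase the loss of the aggregate above that of its leading term.
\<close>

lemma aew_risk_ge:
  assumes ex: "excess n \<le> 1/2" and j: "j < m"
    and w: "0 \<le> w" "w \<le> aew_weight n T (coin_dictionary n m) D (coord j)"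
  shows "design_risk m (aew n T (coin_dictionary n m) D) \<ge> w\<^sup>2 / 2"
proof -
  let ?F = "coin_dictionary n m"
  have "w\<^sup>2 / 2 = w\<^sup>2 * design_risk m (coord j)" using j by (simp add: risk_coord)
  also have "\<dots> = (\<integral>\<omega>. w\<^sup>2 * quad_loss (fst \<omega>, 0) (coord j) \<partial>coin_design m)"
    by (simp add: risk_def)
  also have "\<dots> \<le> (\<integral>\<omega>. quad_loss (fst \<omega>, 0) (aew n T ?F D) \<partial>coin_design m)"
  proof (intro integral_mono_AE integrable_measure_pmf_finite finite_set_coin_design)
    show "AE \<omega> in measure_pmf (coin_design m).
            w\<^sup>2 * quad_loss (fst \<omega>, 0) (coord j) \<le> quad_loss (fst \<omega>, 0) (aew n T ?F D)"
    proof (rule AE_pmfI)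
      fix \<omega> assume \<omega>: "\<omega> \<in> set_pmf (coin_design m)"
      have cj: "coord j \<in> ?F" using j by (auto simp: coin_dictionary_def)
      have "w * coord j (fst \<omega>) \<le> aew_weight n T ?F D (coord j) * coord j (fst \<omega>)"
        using w coin_dictionary_range(1)[OF ex cj \<omega>] by (intro mult_right_mono) auto
      also have "\<dots> \<le> aew n T ?F D (fst \<omega>)"
        by (intro aew_ge_single finite_coin_dictionary cj coin_dictionary_range(1)[OF ex _ \<omega>])
      finally have "(w * coord j (fst \<omega>))\<^sup>2 \<le> (aew n T ?F D (fst \<omega>))\<^sup>2"
        using w coin_dictionary_range(1)[OF ex cj \<omega>] by (intro power_mono) auto
      then show "w\<^sup>2 * quad_loss (fst \<omega>, 0) (coord j) \<le> quad_loss (fst \<omega>, 0) (aew n T ?F D)"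
        by (simp add: quad_loss_def power_mult_distrib)
    qed
  qed
  also have "\<dots> = design_risk m (aew n T ?F D)" by (simp add: risk_def)
  finally show ?thesis .
qed

text \<open>
  The favourable event, the same for all temperatures and all \<open>\<alpha>\<close>; the oracle is among the
  competitors that the leading coordinate has to beat.
\<close>

definition separated_sample :: "nat \<Rightarrow> nat \<Rightarrow> (nat \<Rightarrow> (nat \<Rightarrow> real) \<times> real) \<Rightarrow> bool" where
  "separated_sample n m D \<longleftrightarrow> (\<exists>j\<in>{..<m}. \<forall>h\<in>coin_dictionary n m - {coord j}.
     real n * emp_risk n D (coord j) + real (gap n) \<le> real n * emp_risk n D h)"

abbreviation (input) coin_sample :: "nat \<Rightarrow> nat \<Rightarrow> (nat \<Rightarrow> (nat \<Rightarrow> real) \<times> real) measure" where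
  "coin_sample n m \<equiv> iid_sample n (measure_pmf (coin_design m)) (count_space UNIV) fst (\<lambda>_. 0)"

lemma separated_sample_sets:
  "{D \<in> space (coin_sample n m). separated_sample n m D} \<in> sets (coin_sample n m)"
proof -
  have meas: "(\<lambda>D. emp_risk n D h) \<in> borel_measurable (coin_sample n m)" for h
  proof -
    have [measurable]: "h \<in> borel_measurable (count_space UNIV)" by simp
    have [measurable]: "(\<lambda>z. quad_loss z h) \<in> borel_measurable (count_space UNIV \<Otimes>\<^sub>M borel)"
      unfolding quad_loss_def by measurable
    show ?thesis unfolding emp_risk_def iid_sample_def by measurable
  qed
  show ?thesis
    unfolding separated_sample_def
    by (intro sets.sets_Collect_finite_Ex sets.sets_Collect_finite_All borel_measurable_le
          borel_measurable_add borel_measurable_times borel_measurable_const meas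
          finite_Diff finite_coin_dictionary finite_lessThan)
qed

text \<open>
  On the support of the sample law, \<open>n\<close> times the empirical risk of a coordinate is the number of ones
  in a column of the sample matrix.
\<close>

lemma separated_sample_prob:
  "measure (coin_sample n m) {D \<in> space (coin_sample n m). separated_sample n m D} =
     measure_pmf.prob (Pi_pmf {..<m} 0 (\<lambda>_. binomial_pmf n (1/2)))
       {c. \<exists>j\<in>{..<m}. (\<forall>i\<in>{..<m} - {j}. c j + gap n \<le> c i) \<and>
                    real (c j) \<le> n * (1/2 - excess n) - gap n}"
  if ex: "excess n \<le> 1/2" and n: "n > 0"
proof -
  let ?Q = "Pi_pmf {..<m} False (\<lambda>_. bernoulli_pmf (1/2))"
  let ?N = "count_space UNIV \<Otimes>\<^sub>M borel :: ((nat \<Rightarrow> real) \<times> real) measure"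
  define h :: "(nat \<Rightarrow> bool) \<Rightarrow> (nat \<Rightarrow> real) \<times> real" where "h = (\<lambda>b. (\<lambda>j. of_bool (b j), 0))"
  define \<phi> where "\<phi> = (\<lambda>\<omega>. \<lambda>i\<in>{1..n}. h (\<omega> i))"
  define R where "R = Pi_pmf {1..n} (\<lambda>_. False) (\<lambda>_. ?Q)"
  have sp: "space ?N = UNIV" by (simp add: space_pair_measure)
  have "distr (measure_pmf (coin_design m)) ?N (\<lambda>\<omega>. (fst \<omega>, 0)) = distr (measure_pmf ?Q) ?N h"
    unfolding coin_design_def map_pmf_rep_eq
    by (subst distr_distr) (auto simp: sp o_def h_def)
  then have law: "coin_sample n m = distr (measure_pmf R) (Pi\<^sub>M {1..n} (\<lambda>_. ?N)) \<phi>"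
    unfolding iid_sample_def R_def \<phi>_def
    by (simp only:) (intro PiM_distr_pmf, auto simp: sp)
  have meas: "\<phi> \<in> measurable (measure_pmf R) (Pi\<^sub>M {1..n} (\<lambda>_. ?N))"
    by (auto simp: \<phi>_def space_PiM sp)
  have "measure (coin_sample n m) {D \<in> space (coin_sample n m). separated_sample n m D}
      = measure_pmf.prob R (\<phi> -` {D \<in> space (coin_sample n m). separated_sample n m D})"
    using separated_sample_sets[of n m] unfolding law by (subst measure_distr[OF meas]) auto
  also have "\<phi> -` {D \<in> space (coin_sample n m). separated_sample n m D} = {\<omega>. separated_sample n m (\<phi> \<omega>)}"
    using measurable_space[OF meas] unfolding law by auto
  also have "\<dots> = (\<lambda>\<omega> j. card {i\<in>{1..n}. \<omega> i j}) -` {c. \<exists>j\<in>{..<m}. (\<forall>i\<in>{..<m} - {j}. c j + gap n \<le> c i) \<and>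
                    real (c j) \<le> n * (1/2 - excess n) - gap n}"
  proof -
    have er: "real n * emp_risk n (\<phi> \<omega>) (coord j) = real (card {i\<in>{1..n}. \<omega> i j})" for \<omega> j
    proof -
      have "(\<Sum>i=1..n. quad_loss (\<phi> \<omega> i) (coord j)) = (\<Sum>i\<in>{1..n}. of_bool (\<omega> i j))"
        by (intro sum.cong) (auto simp: \<phi>_def h_def quad_loss_def coord_def)
      also have "\<dots> = real (card {i\<in>{1..n}. \<omega> i j})"
        by (simp add: of_bool_def sum.If_cases Int_def)
      finally show ?thesis using n by (simp add: emp_risk_def)
    qed
    have ec: "real n * emp_risk n (\<phi> \<omega>) (const_pred n) = n * (1/2 - excess n)" for \<omega>
    proof -
      have "(\<Sum>i=1..n. quad_loss (\<phi> \<omega> i) (const_pred n)) = (\<Sum>i\<in>{1..n}. 1/2 - excess n)"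
        using ex by (intro sum.cong) (auto simp: \<phi>_def h_def quad_loss_def const_pred_def)
      then show ?thesis using n by (simp add: emp_risk_def)
    qed
    have dict: "coin_dictionary n m - {coord j} = insert (const_pred n) (coord ` ({..<m} - {j}))" for j
      using inj_coord coord_neq_const[of j n] by (auto simp: coin_dictionary_def inj_def)
    have key: "real a + real b \<le> real c \<longleftrightarrow> a + b \<le> c" for a b c
      by linarith
    have beats: "(\<forall>h\<in>coin_dictionary n m - {coord j}.
          real n * emp_risk n (\<phi> \<omega>) (coord j) + real (gap n) \<le> real n * emp_risk n (\<phi> \<omega>) h) \<longleftrightarrow>
        (\<forall>i\<in>{..<m} - {j}. card {i\<in>{1..n}. \<omega> i j} + gap n \<le> card {k\<in>{1..n}. \<omega> k i}) \<and>
        real (card {i\<in>{1..n}. \<omega> i j}) \<le> n * (1/2 - excess n) - gap n" (is "?L \<longleftrightarrow> ?R") for \<omega> j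
    proof -
      have "?L \<longleftrightarrow>
        (\<forall>i\<in>{..<m} - {j}. real n * emp_risk n (\<phi> \<omega>) (coord j) + real (gap n) \<le> real n * emp_risk n (\<phi> \<omega>) (coord i)) \<and>
        real n * emp_risk n (\<phi> \<omega>) (coord j) + real (gap n) \<le> real n * emp_risk n (\<phi> \<omega>) (const_pred n)"
        unfolding dict by blast
      also have "\<dots> \<longleftrightarrow> ?R" by (simp only: er ec key le_diff_eq)
      finally show ?thesis .
    qed
    show ?thesis
      unfolding separated_sample_def vimage_def mem_Collect_eq beats ..
  qed
  also have "measure_pmf.prob R \<dots> = measure_pmf.prob (map_pmf (\<lambda>\<omega> j. card {i\<in>{1..n}. \<omega> i j}) R)
       {c. \<exists>j\<in>{..<m}. (\<forall>i\<in>{..<m} - {j}. c j + gap n \<le> c i) \<and>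
                    real (c j) \<le> n * (1/2 - excess n) - gap n}"
    by simp
  also have "map_pmf (\<lambda>\<omega> j. card {i\<in>{1..n}. \<omega> i j}) R = Pi_pmf {..<m} 0 (\<lambda>_. binomial_pmf n (1/2))"
    unfolding R_def by (subst column_counts_Pi_pmf) auto
  finally show ?thesis .
qed

section \<open>Weights, risks and probabilities on the coin design\<close>

lemma dictionary_size_bounds:
  "eventually (\<lambda>n. sqrt (real n) + 1 \<le> real (nat \<lceil>sqrt (real n * ln (real n))\<rceil>) \<and>
                   nat \<lceil>sqrt (real n * ln (real n))\<rceil> \<le> n \<and>
                   excess n \<le> 1/4 \<and> 1 / real n \<le> excess n / 2 \<and> 1 \<le> ln (real n)) sequentially"
proof -
  have l1: "eventually (\<lambda>x::real. sqrt x + 1 \<le> sqrt (x * ln x)) at_top" by real_asymp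
  have l2: "eventually (\<lambda>x::real. sqrt (x * ln x) + 1 \<le> x) at_top" by real_asymp
  have l3: "eventually (\<lambda>x::real. sqrt (ln x / x) / 192 \<le> 1/4) at_top" by real_asymp
  have l4: "eventually (\<lambda>x::real. 1 / x \<le> sqrt (ln x / x) / 192 / 2) at_top" by real_asymp
  have l5: "eventually (\<lambda>x::real. 1 \<le> ln x) at_top" by real_asymp
  have ev: "eventually (\<lambda>x::real. sqrt x + 1 \<le> sqrt (x * ln x) \<and> sqrt (x * ln x) + 1 \<le> x \<and>
      sqrt (ln x / x) / 192 \<le> 1/4 \<and> 1 / x \<le> sqrt (ln x / x) / 192 / 2 \<and> 1 \<le> ln x) at_top"
    by (intro eventually_conj l1 l2 l3 l4 l5)
  show ?thesis
  proof (rule eventually_mono[OF eventually_compose_filterlim[OF ev filterlim_real_sequentially]])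
    fix n :: nat
    assume a: "sqrt (real n) + 1 \<le> sqrt (real n * ln (real n)) \<and> sqrt (real n * ln (real n)) + 1 \<le> real n \<and>
      sqrt (ln (real n) / real n) / 192 \<le> 1/4 \<and> 1 / real n \<le> sqrt (ln (real n) / real n) / 192 / 2 \<and> 1 \<le> ln (real n)"
    have "sqrt (real n) + 1 \<le> real (nat \<lceil>sqrt (real n * ln (real n))\<rceil>)" using a by linarith
    moreover have "nat \<lceil>sqrt (real n * ln (real n))\<rceil> \<le> n" using a by linarith
    ultimately show "sqrt (real n) + 1 \<le> real (nat \<lceil>sqrt (real n * ln (real n))\<rceil>) \<and>
                   nat \<lceil>sqrt (real n * ln (real n))\<rceil> \<le> n \<and>
                   excess n \<le> 1/4 \<and> 1 / real n \<le> excess n / 2 \<and> 1 \<le> ln (real n)"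
      using a by (simp add: excess_def)
  qed
qed

lemma separated_sample_eventually_likely:
  assumes \<alpha>: "\<alpha> > 0"
  shows "eventually (\<lambda>n. \<forall>m. sqrt (real n) \<le> m \<and> m \<le> n \<longrightarrow>
           1 - real n powr (\<alpha> - 1/2)
             \<le> measure (coin_sample n m) {D \<in> space (coin_sample n m). separated_sample n m D}) sequentially"
  using separated_minimum_prob[OF \<alpha>, of 0] dictionary_size_bounds eventually_gt_at_top[of 0]
proof (eventually_elim, intro allI impI)
  fix n m :: nat
  let ?P = "measure_pmf.prob (Pi_pmf {..<m} 0 (\<lambda>_. binomial_pmf n (1/2)))"
  let ?G = "{c :: nat \<Rightarrow> nat. \<exists>j\<in>{..<m}. (\<forall>i\<in>{..<m} - {j}. c j + gap n \<le> c i) \<and>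
                          real (c j) \<le> n * (1/2 - excess n) - gap n}"
  assume a: "\<forall>J :: nat set. finite J \<and> sqrt (real n) \<le> card J \<and> card J \<le> n \<longrightarrow>
           measure_pmf.prob (Pi_pmf J 0 (\<lambda>_. binomial_pmf n (1/2)))
             {c. \<not> (\<exists>j\<in>J. (\<forall>i\<in>J - {j}. c j + gap n \<le> c i) \<and>
                          real (c j) \<le> n * (1/2 - excess n) - gap n)} \<le> real n powr (\<alpha> - 1/2)"
    and m: "sqrt (real n) \<le> m \<and> m \<le> n" and n: "n > 0" 
    and b: "sqrt (real n) + 1 \<le> real (nat \<lceil>sqrt (real n * ln (real n))\<rceil>) \<and>
                   nat \<lceil>sqrt (real n * ln (real n))\<rceil> \<le> n \<and>
                   excess n \<le> 1/4 \<and> 1 / real n \<le> excess n / 2 \<and> 1 \<le> ln (real n)"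
  have "1 - ?P ?G = ?P (- ?G)"
    using measure_pmf.prob_compl[of ?G] by (simp add: Compl_eq_Diff_UNIV)
  also have "- ?G = {c. \<not> (\<exists>j\<in>{..<m}. (\<forall>i\<in>{..<m} - {j}. c j + gap n \<le> c i) \<and>
                          real (c j) \<le> n * (1/2 - excess n) - gap n)}" by (rule Collect_neg_eq[symmetric])
  also have "?P \<dots> \<le> real n powr (\<alpha> - 1/2)" using a[rule_format, of "{..<m}"] m by simp
  finally have "1 - real n powr (\<alpha> - 1/2) \<le> ?P ?G" by linarith
  then show "1 - real n powr (\<alpha> - 1/2)
             \<le> measure (coin_sample n m) {D \<in> space (coin_sample n m). separated_sample n m D}"
    using b n by (subst separated_sample_prob) auto
qed

text \<open>
  On the favourable event the leader is a coordinate, and the total weight of its competitors is at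
  most \<open>n * n powr (- 2 / T) \<le> n powr (- 1 / T) \<le> 1 / n\<close> because \<open>T \<le> 1\<close>. Losing twice this
  fraction of the risk \<open>1/2\<close> costs at most half of \<open>excess n\<close>, whose other half is the
  claimed gap \<open>sqrt (ln n / n) / 384\<close>.
\<close>

lemma separated_sample_consequences:
  assumes n: "excess n \<le> 1/4" "1 / real n \<le> excess n / 2" "1 \<le> ln (real n)" and m: "Suc m \<le> n"
    and T: "0 < T" "T \<le> 1" and D: "separated_sample n m D"
  shows "design_risk m (aew n T (coin_dictionary n m) D)
           \<ge> (MIN f\<in>coin_dictionary n m. design_risk m f) + 1/384 * sqrt (ln (Suc m) / real n)" (is ?A)
    and "is_oracle (measure_pmf (coin_design m)) fst (\<lambda>_. 0) (coin_dictionary n m) fs \<Longrightarrow>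
          \<exists>f\<in>coin_dictionary n m. f \<noteq> fs \<and>
            design_risk m f - design_risk m fs > 1/384 * real n powr (- 1/2) \<and>
            aew_weight n T (coin_dictionary n m) D f \<ge> 1 - real n powr (- 1 / T)" (is "?O \<Longrightarrow> ?B")
proof -
  let ?F = "coin_dictionary n m"
  define x where "x = real n"
  have x1: "x > 1"
  proof (rule ccontr)
    assume "\<not> x > 1"
    then have "n = 0 \<or> n = 1" by (auto simp: x_def)
    then show False using n(3) by auto
  qed
  have ex0: "excess n > 0" 
  proof -
    have "0 < 1 / real n" using x1 by (simp add: x_def)
    then show ?thesis using n(2) by linarith
  qed
  obtain j where j: "j < m" and sep: "\<And>h. h \<in> ?F - {coord j} \<Longrightarrow>
       real n * emp_risk n D (coord j) + real (gap n) \<le> real n * emp_risk n D h"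
    using D by (auto simp: separated_sample_def)
  have cj: "coord j \<in> ?F" using j by (auto simp: coin_dictionary_def)
  have cc: "const_pred n \<in> ?F" by (auto simp: coin_dictionary_def)
  have rj: "design_risk m (coord j) = 1/2" by (rule risk_coord[OF j])
  have rc: "design_risk m (const_pred n) = 1/2 - excess n" using n by (intro risk_const) simp
  have weight: "1 - x powr (- 1 / T) \<le> aew_weight n T ?F D (coord j)"
  proof -
    have "real (card ?F) * exp (- real (gap n) / T) \<le> x * exp (- (2 * ln x) / T)"
    proof (intro mult_mono)
      show "real (card ?F) \<le> x" using m by (simp add: card_coin_dictionary x_def)
      have "2 * ln x \<le> real (gap n)" unfolding gap_def x_def by linarith
      then show "exp (- real (gap n) / T) \<le> exp (- (2 * ln x) / T)" using T by (simp add: divide_right_mono)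
    qed (use x1 in auto)
    also have "\<dots> = exp (ln x - 2 * ln x / T)" using x1 by (simp add: exp_diff exp_minus field_simps)
    also have "\<dots> \<le> exp (- ln x / T)"
    proof -
      have "ln x * T \<le> ln x * 1" using T x1 by (intro mult_left_mono) auto
      then show ?thesis using T by (simp add: field_simps)
    qed
    also have "\<dots> = x powr (- 1 / T)" using x1 by (simp add: powr_def)
    finally have "real (card ?F) * exp (- real (gap n) / T) \<le> x powr (- 1 / T)" .
    moreover have "1 - card ?F * exp (- real (gap n) / T) \<le> aew_weight n T ?F D (coord j)"
      by (rule aew_weight_ge[OF finite_coin_dictionary cj T(1) sep])
    ultimately show ?thesis by linarith
  qed
  have small: "x powr (- 1 / T) \<le> 1 / x"
  proof -
    have "x powr (- 1 / T) \<le> x powr (- 1)" using x1 T by (intro powr_mono) (auto simp: field_simps)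
    then show ?thesis using x1 by (simp add: powr_minus_divide)
  qed
  show ?A
  proof -
    define \<eta> where "\<eta> = x powr (- 1 / T)"
    have \<eta>: "\<eta> \<le> excess n / 2" "\<eta> \<le> 1"
    proof -
      show "\<eta> \<le> excess n / 2" using small n(2) unfolding \<eta>_def x_def by (rule order_trans)
      then show "\<eta> \<le> 1" using n(1) by linarith
    qed
    have "(MIN f\<in>?F. design_risk m f) \<le> 1/2 - excess n"
      using cc finite_coin_dictionary unfolding rc[symmetric] by (intro Min_le) auto
    moreover have "1/384 * sqrt (ln (Suc m) / real n) \<le> excess n / 2"
    proof -
      have "ln (real (Suc m)) \<le> ln (real n)" using m by (subst ln_le_cancel_iff) auto
      then have "sqrt (ln (real (Suc m)) / real n) \<le> sqrt (ln (real n) / real n)"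
        by (intro real_sqrt_le_mono divide_right_mono) auto
      then show ?thesis by (simp add: excess_def)
    qed
    moreover have "1/2 - excess n / 2 \<le> design_risk m (aew n T ?F D)"
    proof -
      have "1/2 - excess n / 2 \<le> (1 - \<eta>)\<^sup>2 / 2"
      proof -
        have "(1 - \<eta>)\<^sup>2 = 1 - 2 * \<eta> + \<eta> * \<eta>" by (simp add: power2_eq_square algebra_simps)
        moreover have "0 \<le> \<eta> * \<eta>" by simp
        ultimately have "1 - excess n \<le> (1 - \<eta>)\<^sup>2" using \<eta>(1) by linarith
        then show ?thesis by simp
      qed
      also have "\<dots> \<le> design_risk m (aew n T ?F D)"
        using n weight \<eta>(2) by (intro aew_risk_ge[OF _ j]) (auto simp: \<eta>_def)
      finally show ?thesis .
    qed
    ultimately show ?A by linarith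
  qed
  show ?B if ?O
  proof -
    have "design_risk m fs \<le> design_risk m (const_pred n)"
      using that cc by (auto simp: is_oracle_def is_arg_min_linorder)
    then have le: "excess n \<le> design_risk m (coord j) - design_risk m fs" using rj rc by simp
    have "1/384 * real n powr (- 1/2) < excess n"
    proof -
      have "real n powr (- 1/2) = sqrt (1 / x)"
        using x1 by (simp add: x_def powr_minus_divide powr_half_sqrt real_sqrt_divide)
      also have "\<dots> \<le> sqrt (ln x / x)" using n x1 by (intro real_sqrt_le_mono divide_right_mono) (auto simp: x_def)
      also have "\<dots> = 192 * excess n" by (simp add: excess_def x_def)
      finally show ?thesis using ex0 by simp
    qed
    with le have gt: "design_risk m (coord j) - design_risk m fs > 1/384 * real n powr (- 1/2)" by linarith
    have "coord j \<noteq> fs" using le ex0 by auto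
    with gt cj weight show ?B unfolding x_def by blast
  qed
qed

theorem theoremB:
  "\<exists>(n0::nat) (c1::real) (c2::real) (c3::real \<Rightarrow> real) (c4::real \<Rightarrow> real) (c5::real \<Rightarrow> real) (c6::real \<Rightarrow> real).
     0 < c1 \<and> 0 < c2 \<and>
     (\<forall>\<alpha>. 0 < \<alpha> \<and> \<alpha> \<le> 1/2 \<longrightarrow> 0 < c3 \<alpha> \<and> 0 < c4 \<alpha> \<and> 0 < c5 \<alpha> \<and> 0 < c6 \<alpha>) \<and>
     (\<forall>n\<ge>n0.
       \<exists>(\<Omega> :: ((nat \<Rightarrow> real) \<times> real) measure) (S :: (nat \<Rightarrow> real) measure) X Y F.
         prob_space \<Omega> \<and> X \<in> measurable \<Omega> S \<and> Y \<in> borel_measurable \<Omega> \<and>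
         dictionary S F \<and> card F = nat \<lceil>c1 * sqrt (real n * ln (real n))\<rceil> \<and>
         (\<forall>f\<in>F. AE \<omega> in \<Omega>. quad_loss (X \<omega>, Y \<omega>) f \<le> 2) \<and>
         (\<forall>\<alpha> T. 0 < \<alpha> \<and> \<alpha> \<le> 1/2 \<and> 0 < T \<and> T \<le> c2 * \<alpha> \<longrightarrow>
           (\<exists>A \<in> sets (iid_sample n \<Omega> S X Y).
              measure (iid_sample n \<Omega> S X Y) A \<ge> 1 - c3 \<alpha> * real n powr (\<alpha> - 1/2) \<and>
              (\<forall>D\<in>A.
                 risk \<Omega> X Y (aew n T F D)
                   \<ge> (MIN f\<in>F. risk \<Omega> X Y f) + c4 \<alpha> * sqrt (ln (real (card F)) / real n) \<and>
                 (\<forall>fs. is_oracle \<Omega> X Y F fs \<longrightarrow>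
                    (\<exists>f\<in>F. f \<noteq> fs \<and>
                       risk \<Omega> X Y f - risk \<Omega> X Y fs > c5 \<alpha> * real n powr (- 1/2) \<and>
                       aew_weight n T F D f \<ge> 1 - real n powr (- c6 \<alpha> / T)))))))"
proof -
  obtain n0 where n0: "\<And>n. n \<ge> n0 \<Longrightarrow> sqrt (real n) + 1 \<le> real (nat \<lceil>sqrt (real n * ln (real n))\<rceil>) \<and>
                   nat \<lceil>sqrt (real n * ln (real n))\<rceil> \<le> n \<and>
                   excess n \<le> 1/4 \<and> 1 / real n \<le> excess n / 2 \<and> 1 \<le> ln (real n)"
    using dictionary_size_bounds unfolding eventually_sequentially by blast
  have "\<forall>\<alpha>. \<exists>n1. \<alpha> > 0 \<longrightarrow> (\<forall>n\<ge>n1. \<forall>m. sqrt (real n) \<le> m \<and> m \<le> n \<longrightarrow>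
           1 - real n powr (\<alpha> - 1/2)
             \<le> measure (coin_sample n m) {D \<in> space (coin_sample n m). separated_sample n m D})"
    using separated_sample_eventually_likely unfolding eventually_sequentially by blast
  from choice[OF this] obtain n1 :: "real \<Rightarrow> nat" where
    "\<forall>\<alpha>. \<alpha> > 0 \<longrightarrow> (\<forall>n\<ge>n1 \<alpha>. \<forall>m. sqrt (real n) \<le> m \<and> m \<le> n \<longrightarrow>
           1 - real n powr (\<alpha> - 1/2)
             \<le> measure (coin_sample n m) {D \<in> space (coin_sample n m). separated_sample n m D})"
    by (elim exE)
  note n1 = this[rule_format]
  \<comment> \<open>The event is only known to be likely for \<open>n \<ge> n1 \<alpha>\<close>. For smaller \<open>n\<close> this choice makes
     \<open>c3 \<alpha> * n powr (\<alpha> - 1/2) \<ge> 1\<close>, and the probability bound becomes trivial.\<close>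
  define c3 where "c3 \<alpha> = sqrt (real (n1 \<alpha>) + 1)" for \<alpha>
  show ?thesis
  proof (rule exI[of _ n0], rule exI[of _ 1], rule exI[of _ 1], rule exI[of _ c3],
      rule exI[of _ "\<lambda>_. 1/384"], rule exI[of _ "\<lambda>_. 1/384"], rule exI[of _ "\<lambda>_. 1"],
      intro conjI allI impI)
    fix n assume nn: "n \<ge> n0"
    define m where "m = nat \<lceil>sqrt (real n * ln (real n))\<rceil> - 1"
    have b: "sqrt (real n) + 1 \<le> real (nat \<lceil>sqrt (real n * ln (real n))\<rceil>)"
            "nat \<lceil>sqrt (real n * ln (real n))\<rceil> \<le> n"
            "excess n \<le> 1/4" "1 / real n \<le> excess n / 2" "1 \<le> ln (real n)"
      using n0[OF nn] by auto
    have s0: "0 \<le> sqrt (real n)" by simp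
    have M: "nat \<lceil>sqrt (real n * ln (real n))\<rceil> = Suc m" using b(1) s0 unfolding m_def by linarith
    have m: "sqrt (real n) \<le> m" "Suc m \<le> n" "m \<le> n" using b(1,2) unfolding M by auto
    have npos: "real n \<ge> 1" using m(2) by linarith
    define F where "F = coin_dictionary n m"
    have event: "\<exists>A \<in> sets (coin_sample n m).
              measure (coin_sample n m) A \<ge> 1 - c3 \<alpha> * real n powr (\<alpha> - 1/2) \<and>
              (\<forall>D\<in>A.
                 design_risk m (aew n T F D)
                   \<ge> (MIN f\<in>F. design_risk m f) + 1/384 * sqrt (ln (real (card F)) / real n) \<and>
                 (\<forall>fs. is_oracle (measure_pmf (coin_design m)) fst (\<lambda>_. 0) F fs \<longrightarrow>
                    (\<exists>f\<in>F. f \<noteq> fs \<and>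
                       design_risk m f - design_risk m fs > 1/384 * real n powr (- 1/2) \<and>
                       aew_weight n T F D f \<ge> 1 - real n powr (- 1 / T))))"
      if \<alpha>: "0 < \<alpha> \<and> \<alpha> \<le> 1/2 \<and> 0 < T \<and> T \<le> 1 * \<alpha>" for \<alpha> T
    proof (intro bexI[OF _ separated_sample_sets] conjI ballI)
      let ?A = "{D \<in> space (coin_sample n m). separated_sample n m D}"
      have T: "0 < T" "T \<le> 1" using \<alpha> by auto
      show "measure (coin_sample n m) ?A \<ge> 1 - c3 \<alpha> * real n powr (\<alpha> - 1/2)"
      proof (cases "n \<ge> n1 \<alpha>")
        case True
        have "1 - c3 \<alpha> * real n powr (\<alpha> - 1/2) \<le> 1 - 1 * real n powr (\<alpha> - 1/2)"
          by (intro diff_left_mono mult_right_mono) (auto simp: c3_def)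
        also have "\<dots> \<le> measure (coin_sample n m) ?A"
          using \<alpha> True m by (simp add: n1)
        finally show ?thesis .
      next
        case False
        have "1 = sqrt (real n) * real n powr (- 1/2)"
          using npos by (simp add: powr_half_sqrt[symmetric] powr_add[symmetric])
        also have "\<dots> \<le> c3 \<alpha> * real n powr (\<alpha> - 1/2)"
          using False npos \<alpha> by (intro mult_mono powr_mono) (auto simp: c3_def)
        finally have "1 - c3 \<alpha> * real n powr (\<alpha> - 1/2) \<le> 0" by simp
        also have "0 \<le> measure (coin_sample n m) ?A" by simp
        finally show ?thesis .
      qed
      fix D assume "D \<in> ?A"
      then have D: "separated_sample n m D" by simp
      note cons = separated_sample_consequences[OF b(3-5) m(2) T D]
      show "design_risk m (aew n T F D)
              \<ge> (MIN f\<in>F. design_risk m f) + 1/384 * sqrt (ln (real (card F)) / real n)"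
        using cons(1) by (simp add: F_def card_coin_dictionary)
      show "\<forall>fs. is_oracle (measure_pmf (coin_design m)) fst (\<lambda>_. 0) F fs \<longrightarrow>
                    (\<exists>f\<in>F. f \<noteq> fs \<and>
                       design_risk m f - design_risk m fs > 1/384 * real n powr (- 1/2) \<and>
                       aew_weight n T F D f \<ge> 1 - real n powr (- 1 / T))"
        using cons(2) unfolding F_def by blast
    qed
    have bounded: "\<forall>f\<in>F. AE \<omega> in measure_pmf (coin_design m). quad_loss (fst \<omega>, 0) f \<le> 2"
    proof (intro ballI AE_pmfI)
      fix f \<omega> assume "f \<in> F" "\<omega> \<in> set_pmf (coin_design m)"
      then have "(f (fst \<omega>))\<^sup>2 \<le> 1" using b(3) coin_dictionary_range(2)[of n f m \<omega>] by (simp add: F_def)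
      then show "quad_loss (fst \<omega>, 0) f \<le> 2" by (simp add: quad_loss_def)
    qed
    show "\<exists>(\<Omega> :: ((nat \<Rightarrow> real) \<times> real) measure) (S :: (nat \<Rightarrow> real) measure) X Y F.
         prob_space \<Omega> \<and> X \<in> measurable \<Omega> S \<and> Y \<in> borel_measurable \<Omega> \<and>
         dictionary S F \<and> card F = nat \<lceil>1 * sqrt (real n * ln (real n))\<rceil> \<and>
         (\<forall>f\<in>F. AE \<omega> in \<Omega>. quad_loss (X \<omega>, Y \<omega>) f \<le> 2) \<and>
         (\<forall>\<alpha> T. 0 < \<alpha> \<and> \<alpha> \<le> 1/2 \<and> 0 < T \<and> T \<le> 1 * \<alpha> \<longrightarrow>
           (\<exists>A \<in> sets (iid_sample n \<Omega> S X Y).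
              measure (iid_sample n \<Omega> S X Y) A \<ge> 1 - c3 \<alpha> * real n powr (\<alpha> - 1/2) \<and>
              (\<forall>D\<in>A.
                 risk \<Omega> X Y (aew n T F D)
                   \<ge> (MIN f\<in>F. risk \<Omega> X Y f) + 1/384 * sqrt (ln (real (card F)) / real n) \<and>
                 (\<forall>fs. is_oracle \<Omega> X Y F fs \<longrightarrow>
                    (\<exists>f\<in>F. f \<noteq> fs \<and>
                       risk \<Omega> X Y f - risk \<Omega> X Y fs > 1/384 * real n powr (- 1/2) \<and>
                       aew_weight n T F D f \<ge> 1 - real n powr (- 1 / T))))))"
    proof (rule exI[of _ "measure_pmf (coin_design m)"], rule exI[of _ "count_space UNIV"], rule exI[of _ fst],
        rule exI[of _ "\<lambda>_. 0"], rule exI[of _ F], intro conjI)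
      show "\<forall>\<alpha> T. 0 < \<alpha> \<and> \<alpha> \<le> 1/2 \<and> 0 < T \<and> T \<le> 1 * \<alpha> \<longrightarrow>
           (\<exists>A \<in> sets (coin_sample n m).
              measure (coin_sample n m) A \<ge> 1 - c3 \<alpha> * real n powr (\<alpha> - 1/2) \<and>
              (\<forall>D\<in>A.
                 design_risk m (aew n T F D)
                   \<ge> (MIN f\<in>F. design_risk m f) + 1/384 * sqrt (ln (real (card F)) / real n) \<and>
                 (\<forall>fs. is_oracle (measure_pmf (coin_design m)) fst (\<lambda>_. 0) F fs \<longrightarrow>
                    (\<exists>f\<in>F. f \<noteq> fs \<and>
                       design_risk m f - design_risk m fs > 1/384 * real n powr (- 1/2) \<and>
                       aew_weight n T F D f \<ge> 1 - real n powr (- 1 / T)))))"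
        using event by blast
      show "card F = nat \<lceil>1 * sqrt (real n * ln (real n))\<rceil>"
        by (simp add: F_def card_coin_dictionary M)
    qed (use bounded in \<open>auto simp: F_def dictionary_coin measure_pmf.prob_space_axioms\<close>)
  qed (auto simp: c3_def add_nonneg_pos)
qed

end
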